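(* Let $i\ge j\ge0$ and $m,n\ge0$ be integers, let $a\in\mathcal{R}_n$ with $\mathrm{ord}(a)=i$ and $b\in\mathcal{R}_m$ with $\mathrm{ord}(b)=j$ (so $\mathrm{top}(a)\in\mathcal{M}_{n-2i}$, $\mathrm{top}(b)\in\mathcal{M}_{m-2j}$), let $d\in\mathcal{M}_l$ be a common divisor of $\mathrm{top}(a)$ and $\mathrm{top}(b)$, and let $a'\in\mathcal{M}_{n-2i-l}$, $b'\in\mathcal{M}_{m-2j-l}$ satisfy $\mathrm{top}(a)=a'd$, $\mathrm{top}(b)=b'd$. Put $p=(m-2j)(i-j+1)-l-m+n$ and $q=(m-2j)(i-j+1)-l+n$. Then: (1) $\mathrm{top}(b)^{i-j}b'a=cb+c'$ for some $c\in\mathcal{R}_p$ with $\mathrm{ord}(c)=i-j$ and some $c'\in\mathcal{R}_q$ with $\mathrm{ord}(c')<j$; (2) $a\,\mathrm{top}(b)^{i-j}b'=bc+c'$ for some $c\in\mathcal{R}_p$ with $\mathrm{ord}(c)=i-j$ and some $c'\in\mathcal{R}_q$ with $\mathrm{ord}(c')<j$.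
   Context: Let $\mathrm{Hol}$ be the space of holomorphic functions on the upper half plane, $q=e^{2\pi iz}$ (as a variable), $f'=\frac{1}{2\pi i}\frac{df}{dz}$, and $E_2,E_4,E_6$ the Eisenstein series with constant term $1$. For $k\in\mathbb{R}$ let $D_kf=f'-\frac{k}{12}E_2f$. Let $H=\bigoplus_{n\in\mathbb{R}}H_n$ where each $H_n$ is a copy of $\mathrm{Hol}$, elements written $(f,n)$, with product $(f,n)(g,m)=(fg,n+m)$. $\mathrm{End}^i(H)$ denotes the $\mathbb{C}$-linear maps sending each $H_n$ into $H_{n+i}$ and $\mathrm{End}(H)=\bigoplus_i\mathrm{End}^i(H)$. Define $\delta(f,n)=(D_nf,n+2)$, $e_4(f,n)=(E_4f,n+4)$, $e_6(f,n)=(E_6f,n+6)$; $\mathcal{R}=\bigoplus_k\mathcal{R}_k$ is the $\mathbb{C}$-subalgebra of $\mathrm{End}(H)$ generated by $\delta,e_4,e_6$, graded by weight ($\mathcal{R}_k=\mathcal{R}\cap\mathrm{End}^k(H)$). The graded ring $\mathcal{M}=\mathbb{C}[E_4,E_6]=\bigoplus_k\mathcal{M}_k$ of level-one holomorphic modular forms is identified with the subalgebra of $\mathcal{R}$ generated by $e_4,e_6$ via $E_4\mapsto e_4$, $E_6\mapsto e_6$. Every nonzero $a\in\mathcal{R}$ has a unique expression $a=a_n\delta^n+\cdots+a_0$ with $a_i\in\mathcal{M}$, $a_n\neq0$; $\mathrm{top}(a)=a_n$, $\mathrm{ord}(a)=n$, and $\mathrm{ord}(0)=-\infty$. Here the letter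 $q$ in the claim denotes the integer defined there. *)

theory Defs
  imports "HOL-Complex_Analysis.Complex_Analysis" "HOL-Library.Extended_Real"
begin

definition UHP :: "complex set" where
  "UHP = {z. Im z > 0}"

definition qvar :: "complex \<Rightarrow> complex" where
  "qvar z = exp (2 * of_real pi * \<i> * z)"

definition sigma_div :: "nat \<Rightarrow> nat \<Rightarrow> nat" where
  "sigma_div k n = (\<Sum>d\<in>{d. d dvd n}. d ^ k)"

definition E2 :: "complex \<Rightarrow> complex" where
  "E2 z = 1 - 24 * (\<Sum>n. of_nat (sigma_div 1 (Suc n)) * qvar z ^ Suc n)"

definition E4 :: "complex \<Rightarrow> complex" where
  "E4 z = 1 + 240 * (\<Sum>n. of_nat (sigma_div 3 (Suc n)) * qvar z ^ Suc n)"

definition E6 :: "complex \<Rightarrow> complex" where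
  "E6 z = 1 - 504 * (\<Sum>n. of_nat (sigma_div 5 (Suc n)) * qvar z ^ Suc n)"

definition dq :: "(complex \<Rightarrow> complex) \<Rightarrow> complex \<Rightarrow> complex" where
  "dq f z = deriv f z / (2 * of_real pi * \<i>)"

definition Dk :: "real \<Rightarrow> (complex \<Rightarrow> complex) \<Rightarrow> complex \<Rightarrow> complex" where
  "Dk k f z = dq f z - of_real k / 12 * E2 z * f z"

text \<open>An element of H (or more generally a family of components) is a function
  assigning to each weight n the component in H_n.  Operators are maps on such
  families.  Components are normalised: only holomorphic functions on the upper
  half plane are meaningful, and values are taken on UHP only (0 outside).\<close>

type_synonym hfam = "real \<Rightarrow> complex \<Rightarrow> complex"
type_synonym hop = "hfam \<Rightarrow> hfam"

definition hol_lift ::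
  "((complex \<Rightarrow> complex) \<Rightarrow> complex \<Rightarrow> complex) \<Rightarrow> (complex \<Rightarrow> complex) \<Rightarrow> complex \<Rightarrow> complex" where
  "hol_lift T g = (if g holomorphic_on UHP then (\<lambda>z. if z \<in> UHP then T g z else 0) else (\<lambda>z. 0))"

definition delta_op :: hop where
  "delta_op F = (\<lambda>w. hol_lift (Dk (w - 2)) (F (w - 2)))"

definition e4_op :: hop where
  "e4_op F = (\<lambda>w. hol_lift (\<lambda>g z. E4 z * g z) (F (w - 4)))"

definition e6_op :: hop where
  "e6_op F = (\<lambda>w. hol_lift (\<lambda>g z. E6 z * g z) (F (w - 6)))"

datatype gen = Gdelta | Ge4 | Ge6

fun gen_op :: "gen \<Rightarrow> hop" where
  "gen_op Gdelta = delta_op"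
| "gen_op Ge4 = e4_op"
| "gen_op Ge6 = e6_op"

definition word_op :: "gen list \<Rightarrow> hop" where
  "word_op ws = foldr (\<circ>) (map gen_op ws) id"

definition op_zero :: hop where
  "op_zero = (\<lambda>F w z. 0)"

definition op_add :: "hop \<Rightarrow> hop \<Rightarrow> hop" where
  "op_add A B = (\<lambda>F w z. A F w z + B F w z)"

text \<open>C-linear span of a set of words (the subalgebra generated by the generators
  occurring in these words, when the set is closed under concatenation).\<close>
definition span_words :: "gen list set \<Rightarrow> hop set" where
  "span_words W = {T. \<exists>S c. finite S \<and> S \<subseteq> W \<and>
      T = (\<lambda>F w z. \<Sum>u\<in>S. c u * word_op u F w z)}"

definition Rring :: "hop set" where
  "Rring = span_words UNIV"

definition Mring :: "hop set" where
  "Mring = span_words {ws. set ws \<subseteq> {Ge4, Ge6}}"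

definition hsingle :: "real \<Rightarrow> (complex \<Rightarrow> complex) \<Rightarrow> hfam" where
  "hsingle n g = (\<lambda>w. if w = n then g else (\<lambda>z. 0))"

definition End_deg :: "real \<Rightarrow> hop set" where
  "End_deg k = {T. \<forall>n g. g holomorphic_on UHP \<longrightarrow> (\<exists>g'. T (hsingle n g) = hsingle (n + k) g')}"

definition Rk :: "real \<Rightarrow> hop set" where
  "Rk k = Rring \<inter> End_deg k"

definition Mk :: "real \<Rightarrow> hop set" where
  "Mk k = Mring \<inter> End_deg k"

definition is_expansion :: "hop \<Rightarrow> nat \<Rightarrow> (nat \<Rightarrow> hop) \<Rightarrow> bool" where
  "is_expansion a N cs \<longleftrightarrow> (\<forall>i\<le>N. cs i \<in> Mring) \<and> cs N \<noteq> op_zero \<and>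
      a = (\<lambda>F w z. \<Sum>i\<le>N. (cs i \<circ> (delta_op ^^ i)) F w z)"

definition ord :: "hop \<Rightarrow> ereal" where
  "ord a = (if a = op_zero then -\<infinity> else ereal (real (THE N. \<exists>cs. is_expansion a N cs)))"

definition top :: "hop \<Rightarrow> hop" where
  "top a = (THE t. \<exists>N cs. is_expansion a N cs \<and> t = cs N)"

end

theory Submission
  imports Defs "HOL-Library.Function_Algebras"
begin

text \<open>The commutators of \<open>\<delta>\<close> with \<open>e\<^sub>4\<close> and \<open>e\<^sub>6\<close> are multiplications by modular forms, by
  Ramanujan's formulas for \<open>E\<^sub>4'\<close> and \<open>E\<^sub>6'\<close>. Hence every element of the ring has an expansion in powers
  of \<open>\<delta>\<close>, and leading coefficients multiply like commuting holomorphic functions; the theorem is then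
  pseudo-division of skew polynomials, the common factor \<open>d\<close> saving one power of \<open>top b\<close> in the first step.

  Comparing coefficients of \<open>q\<close>-series, Ramanujan's formulas become convolution identities for divisor
  sums. These follow from the bijection \<open>(a, b, x, y) \<mapsto> (a - b, b, x, x + y)\<close> from the solutions of
  \<open>a x + b y = n\<close> with \<open>b < a\<close> to those with \<open>x < y\<close>: if \<open>r (a, b)\<close> and \<open>r (a - b, b)\<close> are both symmetric,
  then the sums of \<open>r (a, b)\<close> and \<open>r (a - b, b)\<close> over all positive solutions differ only by sums over
  diagonals. Such \<open>r\<close> are the invariants \<open>(a b (a + b))\<^sup>2\<close> and \<open>(a\<^sup>2 + a b + b\<^sup>2)\<^sup>k\<close>.\<close>

section \<open>Convolutions of divisor sums\<close>

text \<open>The commutators stay inside the ring of \<open>E4\<close> and \<open>E6\<close> because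
  the terms with \<open>E2\<close> cancel in \<open>Dk 4 E4\<close> and \<open>Dk 6 E6\<close>,
  although \<open>E2\<close> occurs in \<open>delta_op\<close> itself. \<open>ord\<close> and
  \<open>top\<close> are definite descriptions over all expansions, homogeneous or not, so nothing
  can be said about them before expansions are known to be unique. Uniqueness rests on the fact that
  a Serre derivative lowers the order of a zero by exactly one. That the quotient has order exactly
  \<open>i - j\<close>, and not merely at most that, requires a product of nonzero modular forms to
  be nonzero; this is the identity theorem on the connected half plane. A further obstacle is the
  ambient type: operators act on arbitrary families of functions and discard non-holomorphic
  components, so they are not linear there. All algebra is therefore done in the spans
  \<open>RW\<close> and \<open>MW\<close> of words of one weight, which turn out to be
  \<open>Rk\<close> and \<open>Mk\<close>.\<close>

definition quads :: "nat \<Rightarrow> (nat \<times> nat \<times> nat \<times> nat) set" where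
  "quads n = {(a, b, x, y). a > 0 \<and> b > 0 \<and> x > 0 \<and> y > 0 \<and> a * x + b * y = n}"

lemma finite_quads: "finite (quads n)"
proof (rule finite_subset)
  show "quads n \<subseteq> {..n} \<times> {..n} \<times> {..n} \<times> {..n}"
  proof -
    have "u \<le> u * v" if "v > 0" for u v :: nat using that by simp
    moreover have "v \<le> u * v" if "u > 0" for u v :: nat using that by simp
    ultimately show ?thesis
      unfolding quads_def by (auto; meson le_add1 le_add2 le_trans)
  qed
qed auto

lemma sum_quads_swap:
  "(\<Sum>(a, b, x, y) | (a, b, x, y) \<in> quads n \<and> P a b x y. f a b x y) =
   (\<Sum>(a, b, x, y) | (a, b, x, y) \<in> quads n \<and> P b a y x. f b a y x)"
  by (rule sum.reindex_bij_witness[where i = "\<lambda>(a, b, x, y). (b, a, y, x)"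
        and j = "\<lambda>(a, b, x, y). (b, a, y, x)"]) (auto simp: quads_def)

lemma shear_eq:
  fixes a b x y :: nat
  shows "b < a \<Longrightarrow> (a - b) * x + b * (x + y) = a * x + b * y"
    and "x < y \<Longrightarrow> (a + b) * x + b * (y - x) = a * x + b * y"
proof -
  assume "b < a"
  then obtain k where "a = b + k" using less_imp_add_positive by blast
  then show "(a - b) * x + b * (x + y) = a * x + b * y" by (simp add: algebra_simps)
next
  assume "x < y"
  then obtain k where "y = x + k" using less_imp_add_positive by blast
  then show "(a + b) * x + b * (y - x) = a * x + b * y" by (simp add: algebra_simps)
qed

lemma sum_quads_shear:
  "(\<Sum>(a, b, x, y) | (a, b, x, y) \<in> quads n \<and> x < y. f a b x y) =
   (\<Sum>(a, b, x, y) | (a, b, x, y) \<in> quads n \<and> b < a. f (a - b) b x (x + y))"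
  by (rule sum.reindex_bij_witness[where i = "\<lambda>(a, b, x, y). (a - b, b, x, x + y)"
        and j = "\<lambda>(a, b, x, y). (a + b, b, x, y - x)"])
     (auto simp: quads_def shear_eq)

text \<open>Generic in \<open>u\<close> and \<open>v\<close>, since the same solutions are split
  once by comparing \<open>x\<close> with \<open>y\<close> and once by comparing \<open>a\<close>
  with \<open>b\<close>.\<close>

lemma sum_quads_split:
  fixes f :: "nat \<Rightarrow> nat \<Rightarrow> nat \<Rightarrow> nat \<Rightarrow> complex" and u v :: "nat \<Rightarrow> nat \<Rightarrow> nat \<Rightarrow> nat \<Rightarrow> nat"
  shows "(\<Sum>(a, b, x, y) \<in> quads n. f a b x y) =
     (\<Sum>(a, b, x, y) | (a, b, x, y) \<in> quads n \<and> u a b x y < v a b x y. f a b x y)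
   + (\<Sum>(a, b, x, y) | (a, b, x, y) \<in> quads n \<and> v a b x y < u a b x y. f a b x y)
   + (\<Sum>(a, b, x, y) | (a, b, x, y) \<in> quads n \<and> u a b x y = v a b x y. f a b x y)"
proof -
  define L where "L = {(a, b, x, y). (a, b, x, y) \<in> quads n \<and> u a b x y < v a b x y}"
  define G where "G = {(a, b, x, y). (a, b, x, y) \<in> quads n \<and> v a b x y < u a b x y}"
  define E where "E = {(a, b, x, y). (a, b, x, y) \<in> quads n \<and> u a b x y = v a b x y}"
  have *: "quads n = (L \<union> G) \<union> E"
    unfolding L_def G_def E_def by (auto simp only: split_paired_all mem_Collect_eq prod.case Un_iff)
  then have "finite L" "finite G" "finite E"
    using finite_quads[of n] by (metis finite_Un)+
  moreover have "L \<inter> G = {}" "(L \<union> G) \<inter> E = {}"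
    unfolding L_def G_def E_def by auto
  ultimately have "(\<Sum>(a, b, x, y) \<in> quads n. f a b x y) =
      (\<Sum>(a, b, x, y) \<in> L. f a b x y) + (\<Sum>(a, b, x, y) \<in> G. f a b x y) + (\<Sum>(a, b, x, y) \<in> E. f a b x y)"
    unfolding * by (simp add: sum.union_disjoint)
  then show ?thesis unfolding L_def G_def E_def .
qed

lemma dvd_div_pos: "d dvd n \<Longrightarrow> 0 < n \<Longrightarrow> 0 < n div (d::nat)"
  by (metis dvd_div_eq_0_iff gr0I)

text \<open>On \<open>x = y\<close> the equation reads \<open>(a + b) * x = n\<close>, so the
  divisor is \<open>d = a + b\<close> and \<open>x = n div d\<close> is forced.\<close>

lemma sum_quads_diag_xy:
  assumes "n > 0"
  shows "(\<Sum>(a, b, x, y) | (a, b, x, y) \<in> quads n \<and> x = y. f a b) =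
    (\<Sum>d | d dvd n. \<Sum>a\<in>{0<..<d}. f a (d - a))"
proof -
  have "(\<Sum>d | d dvd n. \<Sum>a\<in>{0<..<d}. f a (d - a)) = (\<Sum>(d, a)\<in>Sigma {d. d dvd n} (\<lambda>d. {0<..<d}). f a (d - a))"
    using assms by (simp add: sum.Sigma)
  also have "\<dots> = (\<Sum>(a, b, x, y) | (a, b, x, y) \<in> quads n \<and> x = y. f a b)"
    using assms
    by (intro sum.reindex_bij_witness[where j = "\<lambda>(d, a). (a, d - a, n div d, n div d)"
        and i = "\<lambda>(a, b, x, y). (a + b, a)"])
       (auto simp: quads_def add_mult_distrib[symmetric] dvd_div_pos)
  finally show ?thesis ..
qed

text \<open>On \<open>a = b\<close> the equation reads \<open>a * (x + y) = n\<close>; the factor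
  counts the ways to write \<open>n div d\<close> as a sum of two positive numbers.\<close>

lemma sum_quads_diag_ab:
  assumes "n > 0"
  shows "(\<Sum>(a, b, x, y) | (a, b, x, y) \<in> quads n \<and> a = b. f a b) =
    (\<Sum>d | d dvd n. of_nat (n div d - 1) * (f d d :: complex))"
proof -
  have "(\<Sum>d | d dvd n. of_nat (n div d - 1) * (f d d)) = (\<Sum>d | d dvd n. \<Sum>x\<in>{0<..<n div d}. f d d)"
    by simp
  also have "\<dots> = (\<Sum>(d, a)\<in>Sigma {d. d dvd n} (\<lambda>d. {0<..<n div d}). f d d)"
    using assms by (subst sum.Sigma) auto
  also have "\<dots> = (\<Sum>(a, b, x, y) | (a, b, x, y) \<in> quads n \<and> a = b. f a b)"
    using assms
    by (intro sum.reindex_bij_witness[where j = "\<lambda>(d, x). (d, d, x, n div d - x)"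
        and i = "\<lambda>(a, b, x, y). (a, x)"])
       (auto simp: quads_def add_mult_distrib2[symmetric] dest: dvd_pos_nat)
  finally show ?thesis ..
qed

text \<open>Off its diagonal each of the two sums consists of two equal halves, by symmetry. The
  shear identifies a half of one with a half of the other, so only the diagonals survive in the
  difference.\<close>

lemma sum_quads_symmetric:
  fixes r :: "complex \<Rightarrow> complex \<Rightarrow> complex"
  assumes n: "n > 0" and sym: "\<And>a b. r a b = r b a" and sym': "\<And>a b. r (a - b) b = r (b - a) a"
  shows "(\<Sum>(a, b, x, y) \<in> quads n. r (of_nat a) (of_nat b) - r (of_nat a - of_nat b) (of_nat b)) =
    (\<Sum>d | d dvd n. \<Sum>a\<in>{0<..<d}. r (of_nat a) (of_nat d - of_nat a))
    - (\<Sum>d | d dvd n. of_nat (n div d - 1) * r 0 (of_nat d))"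
proof -
  let ?r = "\<lambda>a b x y. r (of_nat a) (of_nat b)"
  let ?t = "\<lambda>a b x y. r (of_nat a - of_nat b) (of_nat b)"
  let ?S = "\<lambda>P f. (\<Sum>(a, b, x, y) | (a, b, x, y) \<in> quads n \<and> P a b x y. f a b x y)"
  have 1: "?S (\<lambda>a b x y. x < y) ?r = ?S (\<lambda>a b x y. y < x) ?r"
    by (subst sum_quads_swap) (simp add: sym)
  have 2: "?S (\<lambda>a b x y. b < a) ?t = ?S (\<lambda>a b x y. a < b) ?t"
    by (subst sum_quads_swap) (simp add: sym')
  have 3: "?S (\<lambda>a b x y. x < y) ?r = ?S (\<lambda>a b x y. b < a) ?t"
    by (subst sum_quads_shear) (rule sum.cong, auto simp: of_nat_diff)
  have 4: "?S (\<lambda>a b x y. x = y) ?r = (\<Sum>d | d dvd n. \<Sum>a\<in>{0<..<d}. r (of_nat a) (of_nat d - of_nat a))"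
    by (subst sum_quads_diag_xy[OF n]) (intro sum.cong, auto simp: of_nat_diff)
  have 5: "?S (\<lambda>a b x y. a = b) ?t = (\<Sum>d | d dvd n. of_nat (n div d - 1) * r 0 (of_nat d))"
    by (subst sum_quads_diag_ab[OF n]) simp
  have "(\<Sum>(a, b, x, y) \<in> quads n. ?r a b x y - ?t a b x y) =
     (\<Sum>(a, b, x, y) \<in> quads n. ?r a b x y) - (\<Sum>(a, b, x, y) \<in> quads n. ?t a b x y)"
    by (simp add: sum_subtractf[symmetric] case_prod_unfold)
  then show ?thesis
    using 1 2 3 4 5 sum_quads_split[of ?r n "\<lambda>a b x y. x" "\<lambda>a b x y. y"]
      sum_quads_split[of ?t n "\<lambda>a b x y. a" "\<lambda>a b x y. b"] by simp
qed

text \<open>A solution is a splitting of \<open>n\<close> into \<open>i = a * x\<close> and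
  \<open>n - i = b * y\<close> together with a divisor of each part.\<close>

lemma sum_quads_powers:
  "(\<Sum>(a, b, x, y) \<in> quads n. (of_nat a :: complex) ^ k * of_nat b ^ l) =
   (\<Sum>i\<in>{0<..<n}. of_nat (sigma_div k i) * of_nat (sigma_div l (n - i)))"
proof -
  have "(\<Sum>i\<in>{0<..<n}. (of_nat (sigma_div k i) :: complex) * of_nat (sigma_div l (n - i))) =
     (\<Sum>i\<in>{0<..<n}. \<Sum>(a, b)\<in>{a. a dvd i} \<times> {b. b dvd (n - i)}. of_nat a ^ k * of_nat b ^ l)"
    by (simp add: sigma_div_def sum_product sum.cartesian_product)
  also have "\<dots> = (\<Sum>(i, a, b)\<in>Sigma {0<..<n} (\<lambda>i. {a. a dvd i} \<times> {b. b dvd (n - i)}). of_nat a ^ k * of_nat b ^ l)"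
    by (subst sum.Sigma) (auto simp: case_prod_unfold)
  also have "\<dots> = (\<Sum>(a, b, x, y) \<in> quads n. of_nat a ^ k * of_nat b ^ l)"
  proof (intro sum.reindex_bij_witness[where j = "\<lambda>(i, a, b). (a, b, i div a, (n - i) div b)"
        and i = "\<lambda>(a, b, x, y). (a * x, a, b)"])
    fix t assume "t \<in> Sigma {0<..<n} (\<lambda>i. {a. a dvd i} \<times> {b. b dvd n - i})"
    then obtain i a b where t: "t = (i, a, b)" "a dvd i" "b dvd n - i" "0 < i" "0 < n - i" "i < n"
      by auto
    moreover have "a > 0" "b > 0" "i div a > 0" "(n - i) div b > 0"
      using t(2-5) by (blast intro: dvd_pos_nat dvd_div_pos)+
    ultimately show "(case t of (i, a, b) \<Rightarrow> (a, b, i div a, (n - i) div b)) \<in> quads n"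
      by (auto simp: quads_def)
  qed (auto simp: quads_def)
  finally show ?thesis ..
qed

text \<open>Faulhaber's formulas. With \<open>a + b = d\<close> fixed, the invariants are
  polynomials in \<open>a\<close> of degree at most 6, so these sums suffice for the diagonal
  \<open>x = y\<close>.\<close>

lemma sum_powers_lessThan:
  "(\<Sum>a<d. of_nat a) = (of_nat d ^ 2 / 2 - of_nat d / 2 :: complex)"
  "(\<Sum>a<d. of_nat a ^ 2) = (of_nat d ^ 3 / 3 - of_nat d ^ 2 / 2 + of_nat d / 6 :: complex)"
  "(\<Sum>a<d. of_nat a ^ 3) = (of_nat d ^ 4 / 4 - of_nat d ^ 3 / 2 + of_nat d ^ 2 / 4 :: complex)"
  "(\<Sum>a<d. of_nat a ^ 4) = (of_nat d ^ 5 / 5 - of_nat d ^ 4 / 2 + of_nat d ^ 3 / 3 - of_nat d / 30 :: complex)"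
  "(\<Sum>a<d. of_nat a ^ 5) = (of_nat d ^ 6 / 6 - of_nat d ^ 5 / 2 + 5 / 12 * of_nat d ^ 4 - of_nat d ^ 2 / 12 :: complex)"
  "(\<Sum>a<d. of_nat a ^ 6) = (of_nat d ^ 7 / 7 - of_nat d ^ 6 / 2 + of_nat d ^ 5 / 2 - of_nat d ^ 3 / 6 + of_nat d / 42 :: complex)"
proof (induction d)
  case (Suc d)
  note step = sum.lessThan_Suc Suc.IH of_nat_Suc
  {
    case 1
    show ?case unfolding step by (simp add: field_simps eval_nat_numeral)
  }
  {
    case 2
    show ?case unfolding step by (simp add: field_simps eval_nat_numeral)
  }
  {
    case 3
    show ?case unfolding step by (simp add: field_simps eval_nat_numeral)
  }
  {
    case 4
    show ?case unfolding step by (simp add: field_simps eval_nat_numeral)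
  }
  {
    case 5
    show ?case unfolding step by (simp add: field_simps eval_nat_numeral)
  }
  {
    case 6
    show ?case unfolding step by (simp add: field_simps eval_nat_numeral)
  }
qed simp_all

lemma sum_greaterThanLessThan_0:
  "d > 0 \<Longrightarrow> (\<Sum>a\<in>{0<..<d}. f a) = (\<Sum>a<d. f a) - (f 0 :: complex)" for d :: nat
proof -
  assume "d > 0"
  then have "{..<d} = insert 0 {0<..<d}" by auto
  then show ?thesis by simp
qed

lemma form_expand:
  fixes A D :: complex
  shows "(A * (D - A) * (A + (D - A))) ^ 2 = D ^ 4 * A ^ 2 - 2 * D ^ 3 * A ^ 3 + D ^ 2 * A ^ 4"
    and "(A ^ 2 + A * (D - A) + (D - A) ^ 2) ^ 2 =
      D ^ 4 - 2 * D ^ 3 * A + 3 * D ^ 2 * A ^ 2 - 2 * D * A ^ 3 + A ^ 4"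
    and "(A ^ 2 + A * (D - A) + (D - A) ^ 2) ^ 3 = D ^ 6 - 3 * D ^ 5 * A + 6 * D ^ 4 * A ^ 2
      - 7 * D ^ 3 * A ^ 3 + 6 * D ^ 2 * A ^ 4 - 3 * D * A ^ 5 + A ^ 6"
proof -
  have form: "A ^ 2 + A * (D - A) + (D - A) ^ 2 = D ^ 2 - A * D + A ^ 2"
    by (simp add: algebra_simps eval_nat_numeral)
  show "(A * (D - A) * (A + (D - A))) ^ 2 = D ^ 4 * A ^ 2 - 2 * D ^ 3 * A ^ 3 + D ^ 2 * A ^ 4"
    by (simp add: algebra_simps eval_nat_numeral)
  show "(A ^ 2 + A * (D - A) + (D - A) ^ 2) ^ 2 =
      D ^ 4 - 2 * D ^ 3 * A + 3 * D ^ 2 * A ^ 2 - 2 * D * A ^ 3 + A ^ 4"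
    unfolding form by (simp add: algebra_simps eval_nat_numeral)
  show "(A ^ 2 + A * (D - A) + (D - A) ^ 2) ^ 3 = D ^ 6 - 3 * D ^ 5 * A + 6 * D ^ 4 * A ^ 2
      - 7 * D ^ 3 * A ^ 3 + 6 * D ^ 2 * A ^ 4 - 3 * D * A ^ 5 + A ^ 6"
    unfolding form by (simp add: algebra_simps eval_nat_numeral)
qed

lemma sum_form_lessThan:
  fixes d :: nat
  defines "D \<equiv> of_nat d :: complex"
  assumes d: "d > 0"
  shows "(\<Sum>a\<in>{0<..<d}. (of_nat a * (D - of_nat a) * (of_nat a + (D - of_nat a))) ^ 2) = (D ^ 7 - D ^ 3) / 30"
    and "(\<Sum>a\<in>{0<..<d}. (of_nat a ^ 2 + of_nat a * (D - of_nat a) + (D - of_nat a) ^ 2) ^ 2) =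
      7 / 10 * D ^ 5 - D ^ 4 + D ^ 3 / 3 - D / 30"
    and "(\<Sum>a\<in>{0<..<d}. (of_nat a ^ 2 + of_nat a * (D - of_nat a) + (D - of_nat a) ^ 2) ^ 3) =
      83 / 140 * D ^ 7 - D ^ 6 + D ^ 5 / 2 - 7 / 60 * D ^ 3 + D / 42"
  unfolding sum_greaterThanLessThan_0[OF d]
  unfolding form_expand sum.distrib sum_subtractf
    sum_distrib_left[symmetric] sum_powers_lessThan[of d, folded D_def] sum_constant card_lessThan D_def[symmetric]
  subgoal by (simp add: field_simps eval_nat_numeral)
  subgoal by (simp add: field_simps eval_nat_numeral)
  subgoal by (simp add: field_simps eval_nat_numeral)
  done

definition sigma_conv :: "nat \<Rightarrow> nat \<Rightarrow> nat \<Rightarrow> complex" where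
  "sigma_conv k l n = (\<Sum>i\<in>{0<..<n}. of_nat (sigma_div k i) * of_nat (sigma_div l (n - i)))"

lemma sigma_conv_commute: "sigma_conv k l n = sigma_conv l k n"
  unfolding sigma_conv_def
  by (rule sum.reindex_bij_witness[where i = "\<lambda>i. n - i" and j = "\<lambda>i. n - i"]) auto

text \<open>For \<open>d dvd n\<close>, \<open>(n div d - 1) * d = n - d\<close>. The part with the
  factor \<open>n\<close> later becomes the derivative \<open>q d/dq\<close> in Ramanujan's
  formulas; the divisor sum of even index cancels against one from the other diagonal.\<close>

lemma sum_dvd_codivisor:
  assumes "n > 0"
  shows "(\<Sum>d | d dvd n. of_nat (n div d - 1) * of_nat d ^ Suc k) =
    of_nat n * of_nat (sigma_div k n) - (of_nat (sigma_div (Suc k) n) :: complex)"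
proof -
  have "of_nat (n div d - 1) * of_nat d ^ Suc k = of_nat n * of_nat d ^ k - (of_nat d ^ Suc k :: complex)"
    if "d dvd n" for d
  proof -
    have "n div d > 0" using that assms by (rule dvd_div_pos)
    then have "of_nat (n div d - 1) = (of_nat (n div d) - 1 :: complex)" by (simp add: of_nat_diff)
    moreover have "of_nat (n div d) * of_nat d = (of_nat n :: complex)"
      using that by (metis dvd_div_mult_self of_nat_mult)
    ultimately show ?thesis by (metis (no_types, lifting) left_diff_distrib mult.assoc mult_1 power_Suc)
  qed
  then show ?thesis by (simp add: sigma_div_def sum_subtractf sum_distrib_left)
qed

lemma sum_dvd_cong:
  fixes f g :: "nat \<Rightarrow> complex"
  assumes n: "n > 0" and "\<And>d. d > 0 \<Longrightarrow> f d = g d"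
  shows "(\<Sum>d | d dvd n. f d) = (\<Sum>d | d dvd n. g d)"
  using assms by (auto intro!: sum.cong dest: dvd_pos_nat)

text \<open>The coefficients of \<open>E_4^2 = E_8\<close>. The invariant vanishes at
  \<open>a = 0\<close>, so the diagonal \<open>a = b\<close> contributes nothing.\<close>

lemma sigma_conv_3_3:
  assumes n: "n > 0"
  shows "120 * sigma_conv 3 3 n = of_nat (sigma_div 7 n) - of_nat (sigma_div 3 n)"
proof -
  let ?r = "\<lambda>a b :: complex. (a * b * (a + b)) ^ 2"
  have sym: "?r a b = ?r b a" "?r (a - b) b = ?r (b - a) a" for a b
    by (simp_all add: algebra_simps eval_nat_numeral)
  have "?r a b - ?r (a - b) b = 4 * (a ^ 3 * b ^ 3)" for a b
    by (simp add: algebra_simps eval_nat_numeral)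
  then have "(\<Sum>(a, b, x, y) \<in> quads n. ?r (of_nat a) (of_nat b) - ?r (of_nat a - of_nat b) (of_nat b)) =
      4 * sigma_conv 3 3 n"
    by (simp add: sigma_conv_def sum_quads_powers[symmetric] sum_distrib_left case_prod_unfold)
  moreover have "(\<Sum>d | d dvd n. \<Sum>a\<in>{0<..<d}. ?r (of_nat a) (of_nat d - of_nat a)) =
      (\<Sum>d | d dvd n. (of_nat d ^ 7 - of_nat d ^ 3) / 30)"
    by (intro sum_dvd_cong n sum_form_lessThan(1))
  ultimately have "4 * sigma_conv 3 3 n = (\<Sum>d | d dvd n. (of_nat d ^ 7 - of_nat d ^ 3) / 30)"
    using sum_quads_symmetric[of n ?r, OF n sym] by simp
  then show ?thesis
    by (simp add: sigma_div_def sum_divide_distrib[symmetric] sum_subtractf field_simps)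
qed

text \<open>Replacing \<open>a\<close> by \<open>a - b\<close> turns the form
  \<open>a^2 + a b + b^2\<close> into \<open>a^2 - a b + b^2\<close>, which is again symmetric. The
  difference of equal powers of the two forms is odd in \<open>a b\<close>, so only divisor sums of
  odd index get convolved.\<close>

lemma sigma_conv_1_3:
  assumes n: "n > 0"
  shows "240 * sigma_conv 1 3 n = 21 * of_nat (sigma_div 5 n) + 10 * of_nat (sigma_div 3 n)
    - of_nat (sigma_div 1 n) - 30 * of_nat n * of_nat (sigma_div 3 n)"
proof -
  let ?r = "\<lambda>a b :: complex. (a ^ 2 + a * b + b ^ 2) ^ 2"
  have sym: "?r a b = ?r b a" "?r (a - b) b = ?r (b - a) a" for a b
    by (simp_all add: algebra_simps eval_nat_numeral)
  have "?r a b - ?r (a - b) b = 4 * (a ^ 1 * b ^ 3) + 4 * (a ^ 3 * b ^ 1)" for a b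
    by (simp add: algebra_simps eval_nat_numeral)
  then have "(\<Sum>(a, b, x, y) \<in> quads n. ?r (of_nat a) (of_nat b) - ?r (of_nat a - of_nat b) (of_nat b)) =
      4 * sigma_conv 1 3 n + 4 * sigma_conv 3 1 n"
    unfolding sigma_conv_def sum_quads_powers[symmetric]
    by (simp add: sum_distrib_left sum.distrib case_prod_unfold)
  also have "\<dots> = 8 * sigma_conv 1 3 n"
    unfolding sigma_conv_commute[of 3 1] by simp
  finally have "8 * sigma_conv 1 3 n =
      (\<Sum>d | d dvd n. \<Sum>a\<in>{0<..<d}. ?r (of_nat a) (of_nat d - of_nat a))
      - (\<Sum>d | d dvd n. of_nat (n div d - 1) * ?r 0 (of_nat d))"
    using sum_quads_symmetric[of n ?r, OF n sym] by simp
  also have "(\<Sum>d | d dvd n. \<Sum>a\<in>{0<..<d}. ?r (of_nat a) (of_nat d - of_nat a)) =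
      (\<Sum>d | d dvd n. 7 / 10 * of_nat d ^ 5 - of_nat d ^ 4 + of_nat d ^ 3 / 3 - of_nat d / 30)"
    by (intro sum_dvd_cong n sum_form_lessThan(2))
  also have "\<dots> = 7 / 10 * of_nat (sigma_div 5 n) - of_nat (sigma_div 4 n)
      + of_nat (sigma_div 3 n) / 3 - of_nat (sigma_div 1 n) / 30"
    by (simp add: sigma_div_def sum.distrib sum_subtractf sum_distrib_left sum_divide_distrib)
  finally have *: "8 * sigma_conv 1 3 n = 7 / 10 * of_nat (sigma_div 5 n) - of_nat (sigma_div 4 n)
      + of_nat (sigma_div 3 n) / 3 - of_nat (sigma_div 1 n) / 30
      - (\<Sum>d | d dvd n. of_nat (n div d - 1) * ?r 0 (of_nat d))" .
  have cod: "(\<Sum>d | d dvd n. of_nat (n div d - 1) * ?r 0 (of_nat d)) =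
      of_nat n * of_nat (sigma_div 3 n) - of_nat (sigma_div 4 n)"
    using sum_dvd_codivisor[OF n, of 3] by (simp add: power_mult[symmetric])
  have "240 * sigma_conv 1 3 n = 30 * (8 * sigma_conv 1 3 n)" by simp
  then show ?thesis unfolding * cod by (simp add: algebra_simps)
qed

lemma sigma_conv_1_5:
  assumes n: "n > 0"
  shows "504 * sigma_conv 1 5 n = 20 * of_nat (sigma_div 7 n) + 21 * of_nat (sigma_div 5 n)
    + of_nat (sigma_div 1 n) - 42 * of_nat n * of_nat (sigma_div 5 n)"
proof -
  let ?r = "\<lambda>a b :: complex. (a ^ 2 + a * b + b ^ 2) ^ 3"
  have form: "(a - b) ^ 2 + (a - b) * b + b ^ 2 = a ^ 2 - a * b + b ^ 2" for a b :: complex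
    by (simp add: algebra_simps eval_nat_numeral)
  have sym: "?r a b = ?r b a" "?r (a - b) b = ?r (b - a) a" for a b
    unfolding form by (rule arg_cong[where f = "\<lambda>t. t ^ 3"], simp add: algebra_simps)+
  have "?r a b - ?r (a - b) b = 6 * (a ^ 1 * b ^ 5) + 6 * (a ^ 5 * b ^ 1) + 14 * (a ^ 3 * b ^ 3)" for a b
    unfolding form by (simp add: algebra_simps eval_nat_numeral)
  then have "(\<Sum>(a, b, x, y) \<in> quads n. ?r (of_nat a) (of_nat b) - ?r (of_nat a - of_nat b) (of_nat b)) =
      6 * sigma_conv 1 5 n + 6 * sigma_conv 5 1 n + 14 * sigma_conv 3 3 n"
    unfolding sigma_conv_def sum_quads_powers[symmetric]
    by (simp add: sum_distrib_left sum.distrib case_prod_unfold)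
  also have "\<dots> = 12 * sigma_conv 1 5 n + 14 * sigma_conv 3 3 n"
    unfolding sigma_conv_commute[of 5 1] by simp
  finally have "12 * sigma_conv 1 5 n + 14 * sigma_conv 3 3 n =
      (\<Sum>d | d dvd n. \<Sum>a\<in>{0<..<d}. ?r (of_nat a) (of_nat d - of_nat a))
      - (\<Sum>d | d dvd n. of_nat (n div d - 1) * ?r 0 (of_nat d))"
    using sum_quads_symmetric[of n ?r, OF n sym] by simp
  also have "(\<Sum>d | d dvd n. \<Sum>a\<in>{0<..<d}. ?r (of_nat a) (of_nat d - of_nat a)) =
      (\<Sum>d | d dvd n. 83 / 140 * of_nat d ^ 7 - of_nat d ^ 6 + of_nat d ^ 5 / 2
        - 7 / 60 * of_nat d ^ 3 + of_nat d / 42)"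
    by (intro sum_dvd_cong n sum_form_lessThan(3))
  also have "\<dots> = 83 / 140 * of_nat (sigma_div 7 n) - of_nat (sigma_div 6 n) + of_nat (sigma_div 5 n) / 2
      - 7 / 60 * of_nat (sigma_div 3 n) + of_nat (sigma_div 1 n) / 42"
    by (simp add: sigma_div_def sum.distrib sum_subtractf sum_distrib_left sum_divide_distrib)
  finally have *: "12 * sigma_conv 1 5 n + 14 * sigma_conv 3 3 n = 83 / 140 * of_nat (sigma_div 7 n) - of_nat (sigma_div 6 n) + of_nat (sigma_div 5 n) / 2
      - 7 / 60 * of_nat (sigma_div 3 n) + of_nat (sigma_div 1 n) / 42
      - (\<Sum>d | d dvd n. of_nat (n div d - 1) * ?r 0 (of_nat d))" .
  have cod: "(\<Sum>d | d dvd n. of_nat (n div d - 1) * ?r 0 (of_nat d)) =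
      of_nat n * of_nat (sigma_div 5 n) - of_nat (sigma_div 6 n)"
    using sum_dvd_codivisor[OF n, of 5] by (simp add: power_mult[symmetric])
  \<comment> \<open>\<open>42 = 504 / 12\<close>, and \<open>49 / 10 = 42 * 14 / 120\<close> removes
    the convolution of cubes, whose value is already known.\<close>
  have "504 * sigma_conv 1 5 n =
      42 * (12 * sigma_conv 1 5 n + 14 * sigma_conv 3 3 n) - 49 / 10 * (120 * sigma_conv 3 3 n)" by simp
  then show ?thesis unfolding * cod sigma_conv_3_3[OF n] by (simp add: algebra_simps)
qed

section \<open>Eisenstein series and the Ramanujan identities\<close>

definition eis_coeff :: "complex \<Rightarrow> nat \<Rightarrow> nat \<Rightarrow> complex" where
  "eis_coeff c k n = (if n = 0 then 1 else c * of_nat (sigma_div k n))"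

text \<open>The pairs \<open>(-24, 1)\<close>, \<open>(240, 3)\<close>, \<open>(-504, 5)\<close>
  give \<open>E2\<close>, \<open>E4\<close>, \<open>E6\<close> as functions of \<open>q\<close> on
  the unit disc. The constant term sits among the coefficients so that Cauchy products and termwise
  differentiation apply directly.\<close>

definition eis :: "complex \<Rightarrow> nat \<Rightarrow> complex \<Rightarrow> complex" where
  "eis c k q = (\<Sum>n. eis_coeff c k n * q ^ n)"

text \<open>There are at most \<open>n\<close> divisors, each at most \<open>n\<close>. This crude
  polynomial growth already gives absolute convergence on the unit disc.\<close>

lemma sigma_div_le: "n > 0 \<Longrightarrow> sigma_div k n \<le> n ^ Suc k"
proof -
  assume n: "n > 0"
  have "sigma_div k n \<le> (\<Sum>d | d dvd n. n ^ k)"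
    unfolding sigma_div_def using n by (intro sum_mono power_mono) (auto dest: dvd_imp_le)
  also have "\<dots> \<le> n * n ^ k"
  proof -
    have "{d. d dvd n} \<subseteq> {1..n}" using n by (auto dest: dvd_imp_le dvd_pos_nat)
    then have "card {d. d dvd n} \<le> n" using card_mono[of "{1..n}"] by fastforce
    then show ?thesis by simp
  qed
  finally show ?thesis by simp
qed

lemma summable_power_mult_power:
  fixes r :: real
  assumes "0 \<le> r" "r < 1"
  shows "summable (\<lambda>n. real n ^ k * r ^ n)"
proof (rule root_test_convergence)
  have "(\<lambda>n. root n (real n) ^ k * r) \<longlonglongrightarrow> 1 ^ k * r"
    by (intro tendsto_intros LIMSEQ_root)
  moreover have "\<forall>\<^sub>F n in sequentially. root n (real n) ^ k * r = root n (norm (real n ^ k * r ^ n))"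
    using eventually_gt_at_top[of 0]
    by eventually_elim (use assms in \<open>simp add: real_root_mult real_root_power real_root_power_cancel abs_mult\<close>)
  ultimately show "(\<lambda>n. root n (norm (real n ^ k * r ^ n))) \<longlonglongrightarrow> r"
    by (simp add: tendsto_cong)
qed (use assms in auto)

lemma summable_norm_eis:
  assumes "norm q < 1"
  shows "summable (\<lambda>n. norm (eis_coeff c k n * q ^ n))"
proof (rule summable_comparison_test_ev)
  show "summable (\<lambda>n. norm c * (real n ^ Suc k * norm q ^ n))"
    by (intro summable_mult summable_power_mult_power) (use assms in auto)
  have "norm (eis_coeff c k n * q ^ n) \<le> norm c * (real n ^ Suc k * norm q ^ n)" if "n > 0" for n
  proof -
    have "real (sigma_div k n) \<le> real n ^ Suc k"
      using sigma_div_le[OF that, of k] by (metis of_nat_le_iff of_nat_power)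
    then have "norm c * (real (sigma_div k n) * norm q ^ n) \<le> norm c * (real n ^ Suc k * norm q ^ n)"
      by (intro mult_left_mono mult_right_mono) auto
    then show ?thesis using that by (simp add: eis_coeff_def norm_mult norm_power mult.assoc)
  qed
  then show "\<forall>\<^sub>F n in sequentially. norm (norm (eis_coeff c k n * q ^ n)) \<le> norm c * (real n ^ Suc k * norm q ^ n)"
    using eventually_gt_at_top[of 0] by (simp only: real_norm_def abs_norm_cancel) (erule eventually_mono, simp)
qed

lemma eis_sums:
  assumes "norm q < 1"
  shows "(\<lambda>n. eis_coeff c k n * q ^ n) sums eis c k q"
  unfolding eis_def using summable_norm_eis[OF assms] by (intro summable_sums) (rule summable_norm_cancel)

lemma eis_eq:
  assumes "norm q < 1"
  shows "eis c k q = 1 + c * (\<Sum>n. of_nat (sigma_div k (Suc n)) * q ^ Suc n)"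
proof -
  have "summable (\<lambda>n. eis_coeff c k n * q ^ n)" for c
    using summable_norm_eis[OF assms] by (rule summable_norm_cancel)
  from suminf_split_head[OF this]
  have split: "(\<Sum>n. eis_coeff c k (Suc n) * q ^ Suc n) = eis c k q - 1" for c
    by (simp add: eis_def eis_coeff_def)
  have "summable (\<lambda>n. eis_coeff 1 k (Suc n) * q ^ Suc n)"
    using summable_norm_eis[OF assms, of 1 k] by (subst summable_Suc_iff) (rule summable_norm_cancel)
  from suminf_mult[OF this, of c] split[of c] show ?thesis
    by (simp add: eis_coeff_def mult.assoc)
qed

text \<open>Phrased with \<open>q * d\<close> because \<open>q d/dq\<close> multiplies the n-th
  coefficient by \<open>n\<close>, which allows a comparison coefficient by coefficient, also at
  \<open>q = 0\<close>.\<close>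

lemma eis_has_derivative:
  assumes "norm q < 1"
  shows "\<exists>d. (eis c k has_field_derivative d) (at q) \<and> (\<lambda>n. of_nat n * eis_coeff c k n * q ^ n) sums (q * d)"
proof -
  obtain r where r: "norm q < r" "r < 1" using assms dense by blast
  have "0 \<le> r" using r norm_ge_zero[of q] by linarith
  then have "norm (of_real r :: complex) = r" by simp
  have "summable (\<lambda>n. eis_coeff c k n * of_real r ^ n)"
    using summable_norm_eis[of "of_real r" c k] \<open>norm (of_real r :: complex) = r\<close> r by (auto intro: summable_norm_cancel)
  moreover have "norm q < norm (of_real r :: complex)" using r \<open>norm (of_real r :: complex) = r\<close> by simp
  ultimately have D: "((\<lambda>x. \<Sum>n. eis_coeff c k n * x ^ n) has_field_derivative (\<Sum>n. diffs (eis_coeff c k) n * q ^ n)) (at q)"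
    by (rule termdiffs_strong)
  have "summable (\<lambda>n. diffs (eis_coeff c k) n * q ^ n)"
    by (rule termdiff_converges[OF assms]) (auto intro: summable_norm_cancel summable_norm_eis)
  then have "(\<lambda>n. of_nat n * eis_coeff c k n * q ^ (n - Suc 0)) sums (\<Sum>n. diffs (eis_coeff c k) n * q ^ n)"
    by (rule diffs_equiv)
  then have "(\<lambda>n. q * (of_nat n * eis_coeff c k n * q ^ (n - Suc 0))) sums (q * (\<Sum>n. diffs (eis_coeff c k) n * q ^ n))"
    by (rule sums_mult)
  moreover have "q * (of_nat n * eis_coeff c k n * q ^ (n - Suc 0)) = of_nat n * eis_coeff c k n * q ^ n" for n
    by (cases n) auto
  ultimately show ?thesis using D unfolding eis_def[abs_def] by auto
qed

text \<open>The end terms \<open>i = 0\<close> and \<open>i = n\<close> of the Cauchy product give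
  the single divisor sums, the inner ones the convolution. For \<open>n = 0\<close> the two ends
  coincide, hence the separate value.\<close>

lemma eis_mult_sums:
  assumes "norm q < 1"
  shows "(\<lambda>n. (if n = 0 then 1 else c * of_nat (sigma_div k n) + c' * of_nat (sigma_div l n)
     + c * c' * sigma_conv k l n) * q ^ n) sums (eis c k q * eis c' l q)"
proof -
  have "(\<lambda>n. \<Sum>i\<le>n. (eis_coeff c k i * q ^ i) * (eis_coeff c' l (n - i) * q ^ (n - i))) sums (eis c k q * eis c' l q)"
    unfolding eis_def by (rule Cauchy_product_sums) (rule summable_norm_eis[OF assms])+
  moreover have "(\<Sum>i\<le>n. (eis_coeff c k i * q ^ i) * (eis_coeff c' l (n - i) * q ^ (n - i))) =
     (if n = 0 then 1 else c * of_nat (sigma_div k n) + c' * of_nat (sigma_div l n)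
     + c * c' * sigma_conv k l n) * q ^ n" for n
  proof -
    have "(\<Sum>i\<le>n. (eis_coeff c k i * q ^ i) * (eis_coeff c' l (n - i) * q ^ (n - i))) =
        (\<Sum>i\<le>n. eis_coeff c k i * eis_coeff c' l (n - i)) * q ^ n"
      by (auto simp: sum_distrib_right power_add[symmetric] intro!: sum.cong)
    also have "(\<Sum>i\<le>n. eis_coeff c k i * eis_coeff c' l (n - i)) =
       (if n = 0 then 1 else c * of_nat (sigma_div k n) + c' * of_nat (sigma_div l n) + c * c' * sigma_conv k l n)"
    proof (cases "n = 0")
      case True
      then show ?thesis by (simp add: eis_coeff_def)
    next
      case False
      have "{..n} = insert 0 (insert n {0<..<n})" using False by auto
      moreover have "(\<Sum>i\<in>{0<..<n}. eis_coeff c k i * eis_coeff c' l (n - i)) = c * c' * sigma_conv k l n"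
        by (auto simp: sigma_conv_def eis_coeff_def sum_distrib_left intro!: sum.cong)
      ultimately show ?thesis using False by (simp add: eis_coeff_def)
    qed
    finally show ?thesis .
  qed
  ultimately show ?thesis by simp
qed

text \<open>For \<open>n > 0\<close> the comparison of coefficients is
  \<open>sigma_conv_1_3\<close>, its term with the factor \<open>n\<close> being the left-hand side;
  the constant terms cancel.\<close>

lemma ramanujan_E4_q:
  assumes "norm q < 1"
  shows "q * deriv (eis 240 3) q = (eis (-24) 1 q * eis 240 3 q - eis (-504) 5 q) / 3"
proof -
  obtain d where d: "(eis 240 3 has_field_derivative d) (at q)"
     "(\<lambda>n. of_nat n * eis_coeff 240 3 n * q ^ n) sums (q * d)" using eis_has_derivative[OF assms] by blast
  have "(\<lambda>n. ((if n = 0 then 1 else (-24) * of_nat (sigma_div 1 n) + 240 * of_nat (sigma_div 3 n)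
     + (-24) * 240 * sigma_conv 1 3 n) * q ^ n - eis_coeff (-504) 5 n * q ^ n) / 3) sums
     ((eis (-24) 1 q * eis 240 3 q - eis (-504) 5 q) / 3)"
    by (intro sums_divide sums_diff eis_mult_sums eis_sums assms)
  moreover have "((if n = 0 then 1 else (-24) * of_nat (sigma_div 1 n) + 240 * of_nat (sigma_div 3 n)
     + (-24) * 240 * sigma_conv 1 3 n) * q ^ n - eis_coeff (-504) 5 n * q ^ n) / 3
     = of_nat n * eis_coeff 240 3 n * q ^ n" for n
  proof (cases "n = 0")
    case False
    have "(-24) * 240 * sigma_conv 1 3 n = -24 * (240 * sigma_conv 1 3 n)" by simp
    then have "((-24) * of_nat (sigma_div 1 n) + 240 * of_nat (sigma_div 3 n) + (-24) * 240 * sigma_conv 1 3 n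
        - (-504) * of_nat (sigma_div 5 n)) / 3 = of_nat n * (240 * of_nat (sigma_div 3 n))"
      unfolding sigma_conv_1_3[OF False[unfolded neq0_conv]] by (simp add: field_simps)
    then show ?thesis
      by (simp only: False if_False eis_coeff_def left_diff_distrib[symmetric] times_divide_eq_left[symmetric])
  qed (simp add: eis_coeff_def)
  ultimately have "q * d = (eis (-24) 1 q * eis 240 3 q - eis (-504) 5 q) / 3"
    using sums_unique2[OF d(2)] by (simp only:)
  then show ?thesis using DERIV_imp_deriv[OF d(1)] by simp
qed

lemma ramanujan_E6_q:
  assumes "norm q < 1"
  shows "q * deriv (eis (-504) 5) q = (eis (-24) 1 q * eis (-504) 5 q - eis 240 3 q * eis 240 3 q) / 2"
proof -
  obtain d where d: "(eis (-504) 5 has_field_derivative d) (at q)"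
     "(\<lambda>n. of_nat n * eis_coeff (-504) 5 n * q ^ n) sums (q * d)" using eis_has_derivative[OF assms] by blast
  have "(\<lambda>n. ((if n = 0 then 1 else (-24) * of_nat (sigma_div 1 n) + (-504) * of_nat (sigma_div 5 n)
     + (-24) * (-504) * sigma_conv 1 5 n) * q ^ n -
      (if n = 0 then 1 else 240 * of_nat (sigma_div 3 n) + 240 * of_nat (sigma_div 3 n)
     + 240 * 240 * sigma_conv 3 3 n) * q ^ n) / 2) sums
     ((eis (-24) 1 q * eis (-504) 5 q - eis 240 3 q * eis 240 3 q) / 2)"
    by (intro sums_divide sums_diff eis_mult_sums assms)
  moreover have "((if n = 0 then 1 else (-24) * of_nat (sigma_div 1 n) + (-504) * of_nat (sigma_div 5 n)
     + (-24) * (-504) * sigma_conv 1 5 n) * q ^ n -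
      (if n = 0 then 1 else 240 * of_nat (sigma_div 3 n) + 240 * of_nat (sigma_div 3 n)
     + 240 * 240 * sigma_conv 3 3 n) * q ^ n) / 2
     = of_nat n * eis_coeff (-504) 5 n * q ^ n" for n
  proof (cases "n = 0")
    case False
    have "(-24) * (-504) * sigma_conv 1 5 n = 24 * (504 * sigma_conv 1 5 n)"
      "240 * 240 * sigma_conv 3 3 n = 480 * (120 * sigma_conv 3 3 n)" by simp_all
    then have "((-24) * of_nat (sigma_div 1 n) + (-504) * of_nat (sigma_div 5 n) + (-24) * (-504) * sigma_conv 1 5 n
        - (240 * of_nat (sigma_div 3 n) + 240 * of_nat (sigma_div 3 n) + 240 * 240 * sigma_conv 3 3 n)) / 2
      = of_nat n * ((-504) * of_nat (sigma_div 5 n))"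
      unfolding sigma_conv_1_5[OF False[unfolded neq0_conv]] sigma_conv_3_3[OF False[unfolded neq0_conv]]
      by (simp only: minus_mult_minus mult_minus_left) (simp add: field_simps)
    then show ?thesis
      by (simp only: False if_False eis_coeff_def left_diff_distrib[symmetric] times_divide_eq_left[symmetric])
  qed (simp add: eis_coeff_def)
  ultimately have "q * d = (eis (-24) 1 q * eis (-504) 5 q - eis 240 3 q * eis 240 3 q) / 2"
    using sums_unique2[OF d(2)] by (simp only:)
  then show ?thesis using DERIV_imp_deriv[OF d(1)] by simp
qed


section \<open>Transfer of the q-series to the upper half plane\<close>

lemma open_UHP: "open UHP"
  unfolding UHP_def by (rule open_halfspace_Im_gt)

lemma connected_UHP: "connected UHP"
  unfolding UHP_def by (intro convex_connected convex_halfspace_Im_gt)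

lemma norm_qvar: "z \<in> UHP \<Longrightarrow> norm (qvar z) < 1"
  by (simp add: qvar_def UHP_def)

lemma qvar_has_derivative: "(qvar has_field_derivative 2 * of_real pi * \<i> * qvar z) (at z)"
  unfolding qvar_def[abs_def] by (auto intro!: derivative_eq_intros)

lemma E_eq_eis:
  assumes "z \<in> UHP"
  shows "E2 z = eis (-24) 1 (qvar z)" "E4 z = eis 240 3 (qvar z)" "E6 z = eis (-504) 5 (qvar z)"
  using eis_eq[OF norm_qvar[OF assms], of "-24" 1] eis_eq[OF norm_qvar[OF assms], of "-504" 5]
  by (simp_all add: E2_def E4_def E6_def eis_eq[OF norm_qvar[OF assms]])

text \<open>Chain rule: the factor \<open>2 * of_real pi * \<i>\<close> cancels against the
  normalisation in \<open>dq\<close>, so that \<open>dq\<close> becomes \<open>q d/dq\<close>.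
  Agreement with the series on the open set \<open>UHP\<close> is enough, as outside the series may
  diverge.\<close>

lemma eis_qvar_has_derivative:
  assumes "z \<in> UHP" "\<And>w. w \<in> UHP \<Longrightarrow> f w = eis c k (qvar w)"
  shows "(f has_field_derivative deriv (eis c k) (qvar z) * (2 * of_real pi * \<i> * qvar z)) (at z)"
proof (rule has_field_derivative_transform_within_open)
  obtain d where "(eis c k has_field_derivative d) (at (qvar z))"
    using eis_has_derivative[OF norm_qvar[OF assms(1)]] by blast
  then have "(eis c k has_field_derivative deriv (eis c k) (qvar z)) (at (qvar z))"
    using DERIV_imp_deriv by blast
  then show "((\<lambda>w. eis c k (qvar w)) has_field_derivative
      deriv (eis c k) (qvar z) * (2 * of_real pi * \<i> * qvar z)) (at z)"
    by (rule DERIV_chain2[OF _ qvar_has_derivative])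
qed (use assms open_UHP in auto)

lemma holomorphic_E: "E2 holomorphic_on UHP" "E4 holomorphic_on UHP" "E6 holomorphic_on UHP"
  using eis_qvar_has_derivative[OF _ E_eq_eis(1)] eis_qvar_has_derivative[OF _ E_eq_eis(2)]
    eis_qvar_has_derivative[OF _ E_eq_eis(3)]
  by (auto simp: holomorphic_on_open[OF open_UHP])

lemma ramanujan_E4:
  assumes "z \<in> UHP"
  shows "dq E4 z = (E2 z * E4 z - E6 z) / 3"
  using DERIV_imp_deriv[OF eis_qvar_has_derivative[OF assms E_eq_eis(2)]]
    ramanujan_E4_q[OF norm_qvar[OF assms]]
  by (simp add: dq_def E_eq_eis[OF assms] field_simps)

lemma ramanujan_E6:
  assumes "z \<in> UHP"
  shows "dq E6 z = (E2 z * E6 z - E4 z ^ 2) / 2"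
  using DERIV_imp_deriv[OF eis_qvar_has_derivative[OF assms E_eq_eis(3)]]
    ramanujan_E6_q[OF norm_qvar[OF assms]]
  by (simp add: dq_def E_eq_eis[OF assms] field_simps power2_eq_square)

section \<open>Homogeneous operators\<close>

declare plus_fun_apply [simp del] zero_fun_apply [simp del]

text \<open>Operators, families and their components are nested function types, all with pointwise
  addition. The general pointwise rules would unfold every level at once; this rule only passes from
  operators to families, and \<open>fam_apply\<close> does the rest on demand.\<close>

lemma op_apply [simp]: "(A + B) F = A F + B F" "(0 :: hop) F = 0" for A B :: hop
  by (auto simp: plus_fun_apply zero_fun_apply)

lemma fam_apply: "(F + G) w z = F w z + G w z" "(0 :: hfam) w z = 0" for F G :: hfam
  by (auto simp: plus_fun_apply zero_fun_apply)

definition scal :: "complex \<Rightarrow> hfam \<Rightarrow> hfam" where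
  "scal c F = (\<lambda>w z. c * F w z)"

definition oscal :: "complex \<Rightarrow> hop \<Rightarrow> hop" where
  "oscal c A = (\<lambda>F. scal c (A F))"

text \<open>The families on which the generators are additive: \<open>hol_lift\<close> sends a
  non-holomorphic component to 0, but two such components may have a holomorphic sum.\<close>

definition holfam :: "hfam \<Rightarrow> bool" where
  "holfam F \<longleftrightarrow> (\<forall>w. F w holomorphic_on UHP)"

lemma scal_simps [simp]:
  "scal c 0 = 0" "scal 0 F = 0" "scal 1 F = F"
  "scal c (scal d F) = scal (c * d) F"
  by (auto simp: scal_def fam_apply fun_eq_iff)

lemma scal_apply: "scal c F w z = c * F w z"
  by (simp add: scal_def)

lemma scal_add: "scal c (F + G) = scal c F + scal c G" "scal (c + d) F = scal c F + scal d F"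
  by (auto simp: scal_apply fam_apply fun_eq_iff algebra_simps)

lemma oscal_apply [simp]: "oscal c A F = scal c (A F)"
  by (simp add: oscal_def)

lemma oscal_simps [simp]:
  "oscal c 0 = 0" "oscal 0 A = 0" "oscal 1 A = A" "oscal c (oscal d A) = oscal (c * d) A"
  by (auto simp: oscal_def zero_fun_def[where 'a = hfam])

lemma oscal_add: "oscal c (A + B) = oscal c A + oscal c B" "oscal (c + d) A = oscal c A + oscal d A"
  by (auto simp: scal_apply fam_apply fun_eq_iff algebra_simps)

lemma op_diff_conv: "A - B = A + oscal (-1) B" for A B :: hop
  by (auto simp: fun_eq_iff fam_apply scal_apply)

lemma comp_add_distrib_right: "(A + B) \<circ> C = (A \<circ> C) + (B \<circ> C)" for A B C :: hop
  by (auto simp: fun_eq_iff fam_apply)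

lemma comp_oscal_left [simp]: "oscal c A \<circ> C = oscal c (A \<circ> C)"
  by (auto simp: fun_eq_iff fam_apply)

lemma zero_comp [simp]: "(0 :: hop) \<circ> C = 0" for C :: hop
  by (auto simp: fun_eq_iff fam_apply)

lemma op_zero_eq: "op_zero = 0"
  by (auto simp: fam_apply op_zero_def fun_eq_iff)

lemma op_add_eq: "op_add A B = A + B"
  by (auto simp: fam_apply op_add_def fun_eq_iff)

lemma sum_op_apply: "(\<Sum>i\<in>I. A i) F w z = (\<Sum>i\<in>I. A i F w z)" for A :: "'i \<Rightarrow> hop"
  by (induction I rule: infinite_finite_induct) (auto simp: fam_apply)

lemma holomorphic_UHP_cong:
  "(\<And>z. z \<in> UHP \<Longrightarrow> f z = g z) \<Longrightarrow> f holomorphic_on UHP \<longleftrightarrow> g holomorphic_on UHP"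
  by (rule holomorphic_cong) auto

lemma holfam_add: "holfam F \<Longrightarrow> holfam G \<Longrightarrow> holfam (F + G)"
  by (auto simp: holfam_def plus_fun_def intro: holomorphic_intros)

lemma holfam_scal: "holfam F \<Longrightarrow> holfam (scal c F)"
  by (auto simp: holfam_def scal_def intro: holomorphic_intros)

lemma holomorphic_const_mult_iff:
  fixes c :: complex
  assumes "c \<noteq> 0"
  shows "(\<lambda>z. c * f z) holomorphic_on S \<longleftrightarrow> f holomorphic_on S"
proof -
  have "f holomorphic_on S" if "(\<lambda>z. c * f z) holomorphic_on S"
  proof -
    have "(\<lambda>z. (1 / c) * (c * f z)) holomorphic_on S"
      by (rule holomorphic_on_mult[OF holomorphic_on_const that])
    moreover have "(\<lambda>z. (1 / c) * (c * f z)) = f" using assms by (simp add: fun_eq_iff)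
    ultimately show ?thesis by (simp only:)
  qed
  moreover have "(\<lambda>z. c * f z) holomorphic_on S" if "f holomorphic_on S"
    using that by (intro holomorphic_intros)
  ultimately show ?thesis by blast
qed

section \<open>Generators and words in them\<close>

fun gen_wt :: "gen \<Rightarrow> nat" where
  "gen_wt Gdelta = 2" | "gen_wt Ge4 = 4" | "gen_wt Ge6 = 6"

fun gen_fun :: "gen \<Rightarrow> real \<Rightarrow> (complex \<Rightarrow> complex) \<Rightarrow> complex \<Rightarrow> complex" where
  "gen_fun Gdelta w = Dk w"
| "gen_fun Ge4 w = (\<lambda>g z. E4 z * g z)"
| "gen_fun Ge6 w = (\<lambda>g z. E6 z * g z)"

lemma gen_op_eq: "gen_op g F = (\<lambda>w. hol_lift (gen_fun g (w - real (gen_wt g))) (F (w - real (gen_wt g))))"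
  by (cases g) (auto simp: delta_op_def e4_op_def e6_op_def)

lemma gen_wt_pos: "gen_wt g > 0"
  by (cases g) auto

lemma holomorphic_gen_fun:
  "f holomorphic_on UHP \<Longrightarrow> gen_fun g w f holomorphic_on UHP"
  by (cases g) (auto simp: Dk_def[abs_def] dq_def open_UHP intro!: holomorphic_intros holomorphic_E)

text \<open>Needed because lifted functions are overwritten by 0 outside \<open>UHP\<close>; the
  derivative at a point of the open set \<open>UHP\<close> does not notice this.\<close>

lemma gen_fun_cong:
  assumes "\<And>z. z \<in> UHP \<Longrightarrow> f z = h z" "z \<in> UHP"
  shows "gen_fun g w f z = gen_fun g w h z"
proof -
  have "deriv f z = deriv h z"
    by (rule deriv_cong_ev) (use assms open_UHP in \<open>auto simp: eventually_nhds\<close>)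
  then show ?thesis using assms by (cases g) (auto simp: Dk_def dq_def)
qed

lemma gen_fun_add:
  assumes "f holomorphic_on UHP" "h holomorphic_on UHP" "z \<in> UHP"
  shows "gen_fun g w (\<lambda>z. f z + h z) z = gen_fun g w f z + gen_fun g w h z"
proof -
  have "deriv (\<lambda>z. f z + h z) z = deriv f z + deriv h z"
    using assms open_UHP by (intro deriv_add) (auto intro: holomorphic_on_imp_differentiable_at)
  then show ?thesis by (cases g) (auto simp: Dk_def dq_def algebra_simps add_divide_distrib)
qed

lemma gen_fun_cmult:
  assumes "f holomorphic_on UHP" "z \<in> UHP"
  shows "gen_fun g w (\<lambda>z. c * f z) z = c * gen_fun g w f z"
proof -
  have "deriv (\<lambda>z. c * f z) z = c * deriv f z"
    using assms open_UHP by (intro deriv_cmult) (auto intro: holomorphic_on_imp_differentiable_at)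
  then show ?thesis by (cases g) (auto simp: Dk_def dq_def algebra_simps)
qed

lemma gen_fun_zero [simp]: "gen_fun g w (\<lambda>z. 0) z = 0"
  by (cases g) (auto simp: Dk_def dq_def)

lemma holomorphic_hol_lift:
  "hol_lift (gen_fun g w) f holomorphic_on UHP"
  using holomorphic_UHP_cong[of "\<lambda>z. if z \<in> UHP then gen_fun g w f z else 0" "gen_fun g w f"]
  by (auto simp: hol_lift_def holomorphic_gen_fun)

lemma holfam_gen_op: "holfam (gen_op g F)"
  by (auto simp: holfam_def gen_op_eq holomorphic_hol_lift)

lemma gen_op_add: "holfam F \<Longrightarrow> holfam G \<Longrightarrow> gen_op g (F + G) = gen_op g F + gen_op g G"
  by (auto simp: gen_op_eq hol_lift_def holfam_def fun_eq_iff gen_fun_add plus_fun_def intro: holomorphic_intros)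

lemma gen_op_zero: "gen_op g 0 = 0"
  by (auto simp: gen_op_eq hol_lift_def zero_fun_def fun_eq_iff)

text \<open>Unlike additivity this holds on all families: for \<open>c\<close> nonzero, a function
  and its multiple by \<open>c\<close> are holomorphic together.\<close>

lemma gen_op_scal: "gen_op g (scal c F) = scal c (gen_op g F)"
proof (cases "c = 0")
  case False
  then show ?thesis
    by (auto simp: gen_op_eq hol_lift_def scal_def fun_eq_iff holomorphic_const_mult_iff gen_fun_cmult)
qed (simp add: gen_op_zero)

lemma word_op_Nil [simp]: "word_op [] = id"
  by (simp add: word_op_def)

lemma word_op_Cons: "word_op (g # u) = gen_op g \<circ> word_op u"
  by (simp add: word_op_def)

lemma word_op_append: "word_op (u @ v) = word_op u \<circ> word_op v"
  by (induction u) (auto simp: word_op_Cons o_assoc)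

lemma word_op_replicate_delta: "word_op (replicate N Gdelta) = delta_op ^^ N"
  by (induction N) (auto simp: word_op_Cons)

lemma holfam_word_op: "u \<noteq> [] \<or> holfam F \<Longrightarrow> holfam (word_op u F)"
  by (cases u) (auto simp: word_op_Cons holfam_gen_op)

lemma word_op_add:
  "holfam F \<Longrightarrow> holfam G \<Longrightarrow> word_op u (F + G) = word_op u F + word_op u G"
  by (induction u) (simp_all add: word_op_Cons gen_op_add holfam_word_op)

lemma word_op_scal: "word_op u (scal c F) = scal c (word_op u F)"
  by (induction u) (simp_all only: word_op_Cons word_op_Nil id_apply o_apply gen_op_scal)

lemma word_op_zero: "word_op u 0 = 0"
  by (induction u) (simp_all only: word_op_Cons word_op_Nil id_apply o_apply gen_op_zero)

lemma span_words_induct [consumes 1, case_names zero add]: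
  assumes "A \<in> span_words W" and "P 0"
    and step: "\<And>A c u. A \<in> span_words W \<Longrightarrow> P A \<Longrightarrow> u \<in> W \<Longrightarrow> P (A + oscal c (word_op u))"
  shows "P A"
proof -
  obtain S c where S: "finite S" "S \<subseteq> W" "A = (\<lambda>F w z. \<Sum>u\<in>S. c u * word_op u F w z)"
    using assms(1) by (auto simp: span_words_def)
  have "P (\<lambda>F w z. \<Sum>u\<in>S. c u * word_op u F w z)" using S(1,2)
  proof (induction S rule: finite_induct)
    case empty
    then show ?case using \<open>P 0\<close> by (simp add: zero_fun_def)
  next
    case (insert u S)
    have "(\<lambda>F w z. \<Sum>v\<in>insert u S. c v * word_op v F w z) =
       (\<lambda>F w z. \<Sum>v\<in>S. c v * word_op v F w z) + oscal (c u) (word_op u)"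
      using insert.hyps by (auto simp: fun_eq_iff fam_apply scal_apply add.commute)
    moreover have "(\<lambda>F w z. \<Sum>v\<in>S. c v * word_op v F w z) \<in> span_words W"
      using insert by (auto simp: span_words_def)
    ultimately show ?case using insert step by auto
  qed
  then show ?thesis using S by simp
qed

lemma span_words_zero: "0 \<in> span_words W"
  unfolding span_words_def by (auto intro!: exI[of _ "{}"] simp: fam_apply fun_eq_iff)

lemma span_words_word: "u \<in> W \<Longrightarrow> word_op u \<in> span_words W"
  unfolding span_words_def by (auto intro!: exI[of _ "{u}"] exI[of _ "\<lambda>_. 1"])

lemma span_words_add:
  assumes "A \<in> span_words W" "B \<in> span_words W"
  shows "A + B \<in> span_words W"
proof -
  obtain S c where S: "finite S" "S \<subseteq> W" "A = (\<lambda>F w z. \<Sum>u\<in>S. c u * word_op u F w z)"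
    using assms(1) by (auto simp: span_words_def)
  obtain S' c' where S': "finite S'" "S' \<subseteq> W" "B = (\<lambda>F w z. \<Sum>u\<in>S'. c' u * word_op u F w z)"
    using assms(2) by (auto simp: span_words_def)
  let ?c = "\<lambda>u. (if u \<in> S then c u else 0) + (if u \<in> S' then c' u else 0)"
  have "(\<Sum>u\<in>S \<union> S'. ?c u * f u) = (\<Sum>u\<in>S. c u * f u) + (\<Sum>u\<in>S'. c' u * f u)" for f :: "gen list \<Rightarrow> complex"
  proof -
    have "(\<Sum>u\<in>S \<union> S'. (if u \<in> S then c u else 0) * f u) = (\<Sum>u\<in>S. c u * f u)"
      using S S' by (intro sum.mono_neutral_cong_right) auto
    moreover have "(\<Sum>u\<in>S \<union> S'. (if u \<in> S' then c' u else 0) * f u) = (\<Sum>u\<in>S'. c' u * f u)"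
      using S S' by (intro sum.mono_neutral_cong_right) auto
    ultimately show ?thesis by (simp only: distrib_right sum.distrib)
  qed
  then have "A + B = (\<lambda>F w z. \<Sum>u\<in>S \<union> S'. ?c u * word_op u F w z)"
    unfolding S(3) S'(3) by (auto simp only: fun_eq_iff op_apply fam_apply)
  then show ?thesis using S S' unfolding span_words_def
    by (intro CollectI exI[of _ "S \<union> S'"] exI[of _ ?c]) auto
qed

lemma span_words_oscal: "A \<in> span_words W \<Longrightarrow> oscal c A \<in> span_words W"
proof -
  assume "A \<in> span_words W"
  then obtain S d where S: "finite S" "S \<subseteq> W" "A = (\<lambda>F w z. \<Sum>u\<in>S. d u * word_op u F w z)"
    by (auto simp: span_words_def)
  then have "oscal c A = (\<lambda>F w z. \<Sum>u\<in>S. (c * d u) * word_op u F w z)"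
    by (auto simp: fun_eq_iff fam_apply scal_apply sum_distrib_left mult.assoc)
  then show ?thesis using S unfolding span_words_def
    by (intro CollectI exI[of _ S] exI[of _ "\<lambda>u. c * d u"]) auto
qed

lemma span_words_diff: "A \<in> span_words W \<Longrightarrow> B \<in> span_words W \<Longrightarrow> A - B \<in> span_words W"
  by (simp only: op_diff_conv) (intro span_words_add span_words_oscal)

lemma span_words_mono: "W \<subseteq> W' \<Longrightarrow> span_words W \<subseteq> span_words W'"
  unfolding span_words_def by blast

definition word_wt :: "gen list \<Rightarrow> nat" where
  "word_wt u = sum_list (map gen_wt u)"

lemma word_wt_simps [simp]:
  "word_wt [] = 0" "word_wt (g # u) = gen_wt g + word_wt u" "word_wt (u @ v) = word_wt u + word_wt v"
  "word_wt (replicate N g) = N * gen_wt g"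
  by (auto simp: word_wt_def sum_list_replicate)

lemma word_wt_eq_0_iff: "word_wt u = 0 \<longleftrightarrow> u = []"
  using gen_wt_pos by (cases u) auto

text \<open>Operators are only additive on families with holomorphic components, so composition
  distributes over sums on the left only for homogeneous operators: in weight 0 these are scalars,
  and in all other weights they map every family to one with holomorphic components.\<close>

definition RW :: "real \<Rightarrow> hop set" where
  "RW k = span_words {u. real (word_wt u) = k}"

definition MW :: "real \<Rightarrow> hop set" where
  "MW k = span_words {u. set u \<subseteq> {Ge4, Ge6} \<and> real (word_wt u) = k}"

lemma MW_subset_RW: "MW k \<subseteq> RW k"
  unfolding MW_def RW_def by (rule span_words_mono) auto

lemma MW_subset_Mring: "MW k \<subseteq> Mring"
  unfolding MW_def Mring_def by (rule span_words_mono) auto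

lemma RW_zero: "0 \<in> RW k" and RW_add: "A \<in> RW k \<Longrightarrow> B \<in> RW k \<Longrightarrow> A + B \<in> RW k"
  and RW_oscal: "A \<in> RW k \<Longrightarrow> oscal c A \<in> RW k"
  unfolding RW_def by (auto intro: span_words_zero span_words_add span_words_oscal span_words_diff)

lemma MW_zero: "0 \<in> MW k" and MW_add: "A \<in> MW k \<Longrightarrow> B \<in> MW k \<Longrightarrow> A + B \<in> MW k"
  and MW_oscal: "A \<in> MW k \<Longrightarrow> oscal c A \<in> MW k"
  unfolding MW_def by (auto intro: span_words_zero span_words_add span_words_oscal span_words_diff)

lemma span_words_apply_zero: "A \<in> span_words W \<Longrightarrow> A 0 = 0"
  by (induction rule: span_words_induct) (simp_all add: word_op_zero)

lemma span_words_apply_scal: "A \<in> span_words W \<Longrightarrow> A (scal c F) = scal c (A F)"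
  by (induction rule: span_words_induct) (auto simp: word_op_scal scal_add mult.commute)

lemma holfam_zero: "holfam 0"
  by (auto simp: holfam_def zero_fun_def)

lemma span_words_apply_add:
  "A \<in> span_words W \<Longrightarrow> holfam F \<Longrightarrow> holfam G \<Longrightarrow> A (F + G) = A F + A G"
  by (induction rule: span_words_induct) (auto simp: word_op_add scal_add)

lemma RW_holfam: "A \<in> RW k \<Longrightarrow> k \<noteq> 0 \<Longrightarrow> holfam (A F)"
  unfolding RW_def
  by (induction rule: span_words_induct)
     (auto simp: holfam_zero intro!: holfam_add holfam_scal holfam_word_op)

text \<open>All generators have positive weight, so only the empty word has weight 0.\<close>

lemma RW_0: "A \<in> RW 0 \<Longrightarrow> \<exists>c. A = oscal c id"
  unfolding RW_def
proof (induction rule: span_words_induct)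
  case zero
  have "0 = oscal 0 id" by simp
  then show ?case ..
next
  case (add A c u)
  then obtain d where "A = oscal d id" by blast
  moreover have "u = []" using add word_wt_eq_0_iff by simp
  ultimately have "A + oscal c (word_op u) = oscal (d + c) id" by (simp add: oscal_add)
  then show ?case ..
qed

lemma comp_add_distrib_left:
  assumes "A \<in> span_words W" "B \<in> RW k" "C \<in> RW k"
  shows "A \<circ> (B + C) = (A \<circ> B) + (A \<circ> C)"
proof (cases "k = 0")
  case True
  then obtain b c where bc: "B = oscal b id" "C = oscal c id" using RW_0 assms by blast
  have "A (scal b F + scal c F) = A (scal b F) + A (scal c F)" for F
    using span_words_apply_scal[OF assms(1)] by (metis scal_add(2))
  then show ?thesis unfolding bc by (intro ext) simp
next
  case False
  then show ?thesis
    using span_words_apply_add[OF assms(1)] RW_holfam assms by (auto simp: fun_eq_iff fam_apply)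
qed

lemma comp_oscal_right:
  assumes "A \<in> span_words W"
  shows "A \<circ> oscal c B = oscal c (A \<circ> B)"
  using span_words_apply_scal[OF assms] by (auto simp: fun_eq_iff fam_apply)

lemma comp_zero_right:
  assumes "A \<in> span_words W"
  shows "A \<circ> (0 :: hop) = 0"
  using span_words_apply_zero[OF assms] by (auto simp: fun_eq_iff fam_apply)

lemma word_op_in_UNIV: "word_op u \<in> span_words UNIV"
  by (rule span_words_word) auto

text \<open>Sums in the left factor distribute over composition by definition; sums in the right
  factor do so only within one weight, which is why just \<open>V\<close> is confined to a single
  weight.\<close>

lemma span_words_comp:
  assumes A: "A \<in> span_words W" and B: "B \<in> span_words V" and V: "V \<subseteq> {u. real (word_wt u) = k}"
    and WV: "\<And>u v. u \<in> W \<Longrightarrow> v \<in> V \<Longrightarrow> u @ v \<in> U"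
  shows "A \<circ> B \<in> span_words U"
proof -
  have *: "word_op u \<circ> B \<in> span_words U" if u: "u \<in> W" for u
    using B
  proof (induction rule: span_words_induct)
    case zero
    then show ?case using comp_zero_right[OF word_op_in_UNIV] span_words_zero by metis
  next
    case (add B c v)
    have "B \<in> RW k" "oscal c (word_op v) \<in> RW k"
      using add V span_words_mono[OF V] unfolding RW_def by (auto intro!: span_words_oscal span_words_word)
    then have *: "word_op u \<circ> (B + oscal c (word_op v)) = (word_op u \<circ> B) + oscal c (word_op (u @ v))"
      by (simp only: comp_add_distrib_left[OF word_op_in_UNIV] comp_oscal_right[OF word_op_in_UNIV] word_op_append)
    show ?case unfolding * using add u WV by (blast intro: span_words_add span_words_oscal span_words_word)
  qed
  show ?thesis using A
  proof (induction rule: span_words_induct)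
    case (add A c u)
    then show ?case unfolding comp_add_distrib_right comp_oscal_left
      by (blast intro: span_words_add span_words_oscal *)
  qed (simp only: zero_comp span_words_zero)
qed

lemma RW_comp: "A \<in> RW k \<Longrightarrow> B \<in> RW l \<Longrightarrow> A \<circ> B \<in> RW (k + l)"
  unfolding RW_def by (rule span_words_comp[where k = l]) auto

lemma MW_comp: "A \<in> MW k \<Longrightarrow> B \<in> MW l \<Longrightarrow> A \<circ> B \<in> MW (k + l)"
  unfolding MW_def by (rule span_words_comp[where k = l]) auto

lemma RW_comp_add: "A \<in> RW l \<Longrightarrow> B \<in> RW k \<Longrightarrow> C \<in> RW k \<Longrightarrow> A \<circ> (B + C) = (A \<circ> B) + (A \<circ> C)"
  unfolding RW_def[of l] by (rule comp_add_distrib_left)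

lemma RW_comp_oscal: "A \<in> RW l \<Longrightarrow> A \<circ> oscal c B = oscal c (A \<circ> B)"
  unfolding RW_def[of l] by (rule comp_oscal_right)

lemma RW_comp_zero: "A \<in> RW l \<Longrightarrow> A \<circ> (0 :: hop) = 0"
  unfolding RW_def[of l] by (rule comp_zero_right)

lemma id_in_MW: "id \<in> MW 0"
  unfolding MW_def using span_words_word[of "[]"] by simp

lemma delta_in_RW: "delta_op \<in> RW 2"
  unfolding RW_def using span_words_word[of "[Gdelta]"] by (simp add: word_op_Cons)

lemma delta_power_in_RW: "delta_op ^^ N \<in> RW (2 * real N)"
  unfolding RW_def word_op_replicate_delta[symmetric] by (rule span_words_word) auto

section \<open>Graded components and symbols\<close>

text \<open>What \<open>hol_lift\<close> sees of a component: a non-holomorphic function counts as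
  0.\<close>

definition hol_part :: "(complex \<Rightarrow> complex) \<Rightarrow> complex \<Rightarrow> complex" where
  "hol_part f = (if f holomorphic_on UHP then f else (\<lambda>z. 0))"

lemma holomorphic_hol_part: "hol_part f holomorphic_on UHP"
  by (auto simp: hol_part_def)

lemma hol_lift_hol_part: "hol_lift (gen_fun g w) (hol_part f) = hol_lift (gen_fun g w) f"
  by (auto simp: hol_lift_def hol_part_def fun_eq_iff)

lemma hsingle_same [simp]: "hsingle n f n = f"
  by (simp add: hsingle_def)

lemma gen_op_hsingle:
  "gen_op g (hsingle n f) = hsingle (n + real (gen_wt g)) (hol_lift (gen_fun g n) f)"
  by (auto simp: gen_op_eq hsingle_def hol_lift_def fun_eq_iff)

lemma word_op_hsingle:
  assumes "f holomorphic_on UHP"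
  shows "\<exists>h. h holomorphic_on UHP \<and> word_op u (hsingle n f) = hsingle (n + real (word_wt u)) h"
proof (induction u)
  case Nil
  then show ?case using assms by auto
next
  case (Cons g u)
  then obtain h where "h holomorphic_on UHP" "word_op u (hsingle n f) = hsingle (n + real (word_wt u)) h"
    by blast
  then have "word_op (g # u) (hsingle n f) =
      hsingle (n + real (word_wt (g # u))) (hol_lift (gen_fun g (n + real (word_wt u))) h)"
    by (simp add: word_op_Cons gen_op_hsingle add_ac)
  then show ?case using holomorphic_hol_lift by blast
qed

text \<open>Each generator reads a single component of its argument, and only the holomorphic part
  of it. The empty word is excluded since the identity also keeps non-holomorphic
  components.\<close>

lemma word_op_local:
  assumes "u \<noteq> []"
  shows "word_op u F w =
    word_op u (hsingle (w - real (word_wt u)) (hol_part (F (w - real (word_wt u))))) w"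
  using assms
proof (induction u arbitrary: w)
  case (Cons g u)
  show ?case
  proof (cases "u = []")
    case True
    then show ?thesis by (simp add: word_op_Cons gen_op_eq hol_lift_hol_part)
  next
    case False
    then show ?thesis using Cons.IH[OF False, of "w - real (gen_wt g)"]
      by (simp add: word_op_Cons gen_op_eq algebra_simps)
  qed
qed auto

lemma hsingle_add: "hsingle n f + hsingle n g = hsingle n (\<lambda>z. f z + g z)"
  by (auto simp: hsingle_def fun_eq_iff fam_apply)

lemma hsingle_scal: "scal c (hsingle n f) = hsingle n (\<lambda>z. c * f z)"
  by (auto simp: hsingle_def fun_eq_iff scal_apply)

lemma hsingle_zero: "hsingle n (\<lambda>z. 0) = 0"
  by (auto simp: hsingle_def fun_eq_iff fam_apply)

lemma RW_hsingle:
  assumes "A \<in> RW k" "f holomorphic_on UHP"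
  shows "\<exists>h. h holomorphic_on UHP \<and> A (hsingle n f) = hsingle (n + k) h"
  using assms(1) unfolding RW_def
proof (induction rule: span_words_induct)
  case zero
  then show ?case by (auto intro!: exI[of _ "\<lambda>z. 0"] simp: hsingle_zero)
next
  case (add A c u)
  then obtain h where h: "h holomorphic_on UHP" "A (hsingle n f) = hsingle (n + k) h" by blast
  obtain h' where h': "h' holomorphic_on UHP" "word_op u (hsingle n f) = hsingle (n + k) h'"
    using word_op_hsingle[OF assms(2)] add by blast
  have "(A + oscal c (word_op u)) (hsingle n f) = hsingle (n + k) (\<lambda>z. h z + c * h' z)"
    using h h' by (simp add: hsingle_scal hsingle_add)
  moreover have "(\<lambda>z. h z + c * h' z) holomorphic_on UHP" using h h' by (intro holomorphic_intros)
  ultimately show ?case by blast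
qed

lemma RW_local:
  assumes "A \<in> RW k" "k \<noteq> 0"
  shows "A F w = A (hsingle (w - k) (hol_part (F (w - k)))) w"
  using assms(1) unfolding RW_def
proof (induction rule: span_words_induct)
  case (add A c u)
  then have "u \<noteq> []" using assms(2) by auto
  from word_op_local[OF this, of F w] show ?case using add by (simp add: fun_eq_iff fam_apply scal_apply)
qed (simp add: fun_eq_iff fam_apply)

text \<open>Away from weight 0, locality reduces an arbitrary family to its single components. In
  weight 0 the operator is a scalar, which the constant function 1 detects.\<close>

lemma RW_eq_zero:
  assumes A: "A \<in> RW k" and zero: "\<And>n f. f holomorphic_on UHP \<Longrightarrow> A (hsingle n f) = 0"
  shows "A = 0"
proof (cases "k = 0")
  case True
  then obtain c where c: "A = oscal c id" using A RW_0 by blast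
  have "A (hsingle 0 (\<lambda>z. 1)) = 0" by (rule zero) auto
  from fun_cong[OF fun_cong[OF this], of 0 0] have "c = 0"
    by (simp add: c hsingle_def fam_apply scal_apply)
  then show ?thesis by (simp add: c)
next
  case False
  show ?thesis
  proof
    fix F
    have "A F w = (0 :: hfam) w" for w
      by (subst RW_local[OF A False]) (simp add: zero holomorphic_hol_part)
    then show "A F = (0 :: hop) F" by (auto simp: fun_eq_iff)
  qed
qed

section \<open>Decomposition by weight\<close>

lemma span_words_decomp:
  assumes "T \<in> span_words W"
  shows "\<exists>K A. finite K \<and> (\<forall>k. A k \<in> span_words {u \<in> W. real (word_wt u) = k})
    \<and> (\<forall>k. k \<notin> K \<longrightarrow> A k = 0) \<and> T = (\<Sum>k\<in>K. A k)"
proof -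
  obtain S c where S: "finite S" "S \<subseteq> W" "T = (\<lambda>F w z. \<Sum>u\<in>S. c u * word_op u F w z)"
    using assms by (auto simp: span_words_def)
  define K where "K = (\<lambda>u. real (word_wt u)) ` S"
  define A :: "real \<Rightarrow> hop" where
    "A k = (\<lambda>F w z. \<Sum>u\<in>{u \<in> S. real (word_wt u) = k}. c u * word_op u F w z)" for k
  have "finite K" using S by (simp add: K_def)
  moreover have "A k \<in> span_words {u \<in> W. real (word_wt u) = k}" for k
    unfolding A_def span_words_def using S
    by (intro CollectI exI[of _ "{u \<in> S. real (word_wt u) = k}"] exI[of _ c]) auto
  moreover have "A k = 0" if "k \<notin> K" for k
  proof -
    have "{u \<in> S. real (word_wt u) = k} = {}" using that by (auto simp: K_def)
    then show ?thesis unfolding A_def by (simp only: sum.empty) (auto simp: fun_eq_iff fam_apply)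
  qed
  moreover have "T = (\<Sum>k\<in>K. A k)"
    unfolding S(3) by (intro ext) (simp add: sum_op_apply A_def K_def sum.image_gen[OF S(1), of _ "\<lambda>u. real (word_wt u)"])
  ultimately show ?thesis by blast
qed

text \<open>Different \<open>A k\<close> send \<open>hsingle n f\<close> to different weights, so
  each of them can be read off from the sum.\<close>

lemma sum_hsingle_component:
  assumes "finite K" "\<And>k. A k \<in> RW k" "\<And>k. k \<notin> K \<Longrightarrow> A k = 0" "f holomorphic_on UHP"
  shows "A k (hsingle n f) = hsingle (n + k) ((\<Sum>k\<in>K. A k) (hsingle n f) (n + k))"
proof -
  have *: "A k' (hsingle n f) (n + k) z = (if k' = k then A k (hsingle n f) (n + k) z else 0)" for k' z
    using RW_hsingle[OF assms(2)[of k'] assms(4), of n] by (auto simp: hsingle_def)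
  have "(\<Sum>k\<in>K. A k) (hsingle n f) (n + k) z = A k (hsingle n f) (n + k) z" for z
  proof -
    have "(\<Sum>k\<in>K. A k) (hsingle n f) (n + k) z =
        (\<Sum>k'\<in>K. if k' = k then A k (hsingle n f) (n + k) z else 0)"
      unfolding sum_op_apply by (intro sum.cong refl *)
    also have "\<dots> = A k (hsingle n f) (n + k) z"
      using assms(1) assms(3)[of k] by (simp add: sum.delta fam_apply)
    finally show ?thesis .
  qed
  then have **: "(\<Sum>k\<in>K. A k) (hsingle n f) (n + k) = A k (hsingle n f) (n + k)" ..
  obtain h where "A k (hsingle n f) = hsingle (n + k) h"
    using RW_hsingle[OF assms(2)[of k] assms(4), of n] by blast
  then show ?thesis unfolding ** by simp
qed

lemma RW_subset_End_deg: "RW k \<subseteq> End_deg k"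
  using RW_hsingle by (fastforce simp: End_deg_def)

text \<open>If \<open>T\<close> raises weights by \<open>k\<close>, its components of any other
  weight kill all \<open>hsingle n f\<close> and hence vanish. Thus \<open>Rk\<close> and
  \<open>Mk\<close>, which are defined by how operators act, become spans of words of fixed
  weight.\<close>

lemma span_words_Int_End_deg:
  "span_words W \<inter> End_deg k = span_words {u \<in> W. real (word_wt u) = k}"
proof (intro equalityI subsetI)
  fix T assume "T \<in> span_words {u \<in> W. real (word_wt u) = k}"
  moreover have "span_words {u \<in> W. real (word_wt u) = k} \<subseteq> span_words W"
    "span_words {u \<in> W. real (word_wt u) = k} \<subseteq> RW k"
    unfolding RW_def by (rule span_words_mono, blast)+
  ultimately show "T \<in> span_words W \<inter> End_deg k" using RW_subset_End_deg by blast
next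
  fix T assume T: "T \<in> span_words W \<inter> End_deg k"
  then obtain K A where K: "finite K" "\<And>k. A k \<in> span_words {u \<in> W. real (word_wt u) = k}"
      "\<And>k. k \<notin> K \<Longrightarrow> A k = 0" "T = (\<Sum>k\<in>K. A k)"
    using span_words_decomp[of T W] by auto
  have RW: "A k \<in> RW k" for k
    using K(2) unfolding RW_def by (rule span_words_mono[THEN subsetD, rotated]) blast
  have "A k' = 0" if "k' \<noteq> k" for k'
  proof (rule RW_eq_zero[OF RW])
    fix n f assume f: "f holomorphic_on UHP"
    then obtain g where "T (hsingle n f) = hsingle (n + k) g" using T by (auto simp: End_deg_def)
    then have "T (hsingle n f) (n + k') = (\<lambda>z. 0)" using that by (simp add: hsingle_def)
    then show "A k' (hsingle n f) = 0"
      by (subst sum_hsingle_component[OF K(1) RW K(3) f]) (simp_all add: K(4)[symmetric] hsingle_zero)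
  qed
  then have "T = (\<Sum>k'\<in>K. if k' = k then A k else 0)" unfolding K(4) by (intro sum.cong) auto
  also have "\<dots> = A k" using K(1,3) by (simp add: sum.delta)
  finally show "T \<in> span_words {u \<in> W. real (word_wt u) = k}" using K(2) by simp
qed

lemma Rk_eq: "Rk k = RW k"
  by (simp add: Rk_def Rring_def RW_def span_words_Int_End_deg)

lemma Mk_eq: "Mk k = MW k"
  by (simp add: Mk_def Mring_def MW_def span_words_Int_End_deg conj_commute)

text \<open>For an element of \<open>Mring\<close> this recovers the modular form that it multiplies
  by, split into its weights.\<close>

definition symbol :: "hop \<Rightarrow> real \<Rightarrow> complex \<Rightarrow> complex" where
  "symbol A = A (hsingle 0 (\<lambda>z. 1))"

text \<open>The factor \<open>s\<close> is the same for all \<open>n\<close> and \<open>f\<close>;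
  this is what allows it to be read off from the constant function 1 in weight 0.\<close>

lemma modular_word_op_hsingle:
  assumes "set u \<subseteq> {Ge4, Ge6}"
  shows "\<exists>s. \<forall>n f w. \<forall>z\<in>UHP. f holomorphic_on UHP \<longrightarrow>
    word_op u (hsingle n f) w z = (if w = n + real (word_wt u) then s z * f z else 0)"
  using assms
proof (induction u)
  case Nil
  then show ?case by (auto intro!: exI[of _ "\<lambda>z. 1"] simp: hsingle_def)
next
  case (Cons g u)
  then obtain s where s: "\<And>n f w z. z \<in> UHP \<Longrightarrow> f holomorphic_on UHP \<Longrightarrow>
    word_op u (hsingle n f) w z = (if w = n + real (word_wt u) then s z * f z else 0)" by auto
  define e where "e = (if g = Ge4 then E4 else E6)"
  have e: "gen_fun g w f z = e z * f z" for w f z using Cons.prems by (auto simp: e_def)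
  have "word_op (g # u) (hsingle n f) w z = (if w = n + real (word_wt (g # u)) then (e z * s z) * f z else 0)"
    if "z \<in> UHP" "f holomorphic_on UHP" for n f w z
  proof -
    have "holfam (word_op u (hsingle n f))"
      using that(2) by (intro holfam_word_op) (auto simp: holfam_def hsingle_def)
    then show ?thesis using that
      by (auto simp: word_op_Cons gen_op_eq hol_lift_def holfam_def e s algebra_simps)
  qed
  then show ?case by (intro exI[of _ "\<lambda>z. e z * s z"]) auto
qed

lemma Mring_hsingle:
  assumes "A \<in> Mring" "z \<in> UHP" "f holomorphic_on UHP"
  shows "A (hsingle n f) w z = symbol A (w - n) z * f z"
  using assms(1) unfolding Mring_def
proof (induction rule: span_words_induct)
  case (add A c u)
  obtain s where s: "\<And>n f w z. z \<in> UHP \<Longrightarrow> f holomorphic_on UHP \<Longrightarrow>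
    word_op u (hsingle n f) w z = (if w = n + real (word_wt u) then s z * f z else 0)"
    using modular_word_op_hsingle[of u] add by auto
  then show ?case using add assms
    by (auto simp: symbol_def fam_apply scal_apply algebra_simps)
qed (simp add: symbol_def fam_apply)

text \<open>Symbols only control values on \<open>UHP\<close>. Outside, every nonempty word gives 0
  because of \<open>hol_lift\<close>, and the component of weight 0 is a scalar, tested at the point
  \<open>\<i>\<close>.\<close>

lemma Mring_eq_zero:
  assumes A: "A \<in> Mring" and zero: "\<And>k z. z \<in> UHP \<Longrightarrow> symbol A k z = 0"
  shows "A = 0"
proof -
  obtain K B where K: "finite K" "\<And>k. B k \<in> MW k" "\<And>k. k \<notin> K \<Longrightarrow> B k = 0" "A = (\<Sum>k\<in>K. B k)"
    using span_words_decomp[OF A[unfolded Mring_def]] unfolding MW_def by auto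
  have RW: "B k \<in> RW k" for k using K(2) MW_subset_RW by blast
  have "symbol (B k) l z = 0" if "z \<in> UHP" for k l z
  proof -
    have "B k (hsingle 0 (\<lambda>z. 1)) = hsingle (0 + k) (A (hsingle 0 (\<lambda>z. 1)) (0 + k))"
      unfolding K(4) by (rule sum_hsingle_component[OF K(1) RW K(3)]) auto
    then show ?thesis using zero[OF that, of k] by (auto simp: symbol_def hsingle_def)
  qed
  then have *: "B k (hsingle n f) w z = 0" if "f holomorphic_on UHP" "z \<in> UHP" for k n f w z
    using Mring_hsingle[OF _ that(2,1)] K(2) MW_subset_Mring that by (metis mult_zero_left subsetD)
  have "B k = 0" for k
  proof (cases "k = 0")
    case True
    then obtain c where c: "B k = oscal c id" using RW_0[of "B k"] RW[of k] by auto
    have "c = 0" using *[of "\<lambda>z. 1" \<i> k 0 0] by (simp add: c UHP_def scal_apply hsingle_def)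
    then show ?thesis by (simp add: c)
  next
    case False
    have out: "B k F w z = 0" if "z \<notin> UHP" for F w z
    proof -
      have "A F w z = 0" if "A \<in> RW k" for A
        using that unfolding RW_def
      proof (induction rule: span_words_induct)
        case (add A c u)
        then have "u \<noteq> []" using False by auto
        then obtain g v where "u = g # v" by (cases u) auto
        then show ?case using add \<open>z \<notin> UHP\<close>
          by (simp add: fam_apply scal_apply word_op_Cons gen_op_eq hol_lift_def)
      qed (simp add: fam_apply)
      then show ?thesis using RW by blast
    qed
    show ?thesis
    proof (rule RW_eq_zero[OF RW])
      fix n f assume f: "f holomorphic_on UHP"
      have "B k (hsingle n f) w z = 0" for w z
        using *[OF f, of z] out[of z] by (cases "z \<in> UHP") auto
      then show "B k (hsingle n f) = 0" by (auto simp: fun_eq_iff fam_apply)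
    qed
  qed
  then show ?thesis unfolding K(4) by simp
qed

section \<open>Commuting past the Serre derivative\<close>

lemma Dk_mult:
  assumes "f holomorphic_on UHP" "g holomorphic_on UHP" "z \<in> UHP"
  shows "Dk (k + l) (\<lambda>z. f z * g z) z = Dk k f z * g z + f z * Dk l g z"
proof -
  have "deriv (\<lambda>z. f z * g z) z = f z * deriv g z + deriv f z * g z"
    using assms open_UHP by (intro deriv_mult) (auto intro: holomorphic_on_imp_differentiable_at)
  then show ?thesis by (simp add: Dk_def dq_def field_simps)
qed

lemma Dk_E4: "z \<in> UHP \<Longrightarrow> Dk 4 E4 z = - E6 z / 3"
  by (simp add: Dk_def ramanujan_E4 field_simps)

lemma Dk_E6: "z \<in> UHP \<Longrightarrow> Dk 6 E6 z = - (E4 z ^ 2) / 2"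
  by (simp add: Dk_def ramanujan_E6 field_simps)

text \<open>Common core of both commutators: the Leibniz rule for Serre derivatives, in which the
  weights of the factors add up to \<open>l\<close>.\<close>

lemma hol_lift_Dk_hol_lift_mult:
  assumes "E holomorphic_on UHP" "\<And>z. z \<in> UHP \<Longrightarrow> Dk k E z = c * E' z" "l = k + w"
  shows "hol_lift (Dk l) (hol_lift (\<lambda>g z. E z * g z) f) z =
    hol_lift (\<lambda>g z. E z * g z) (hol_lift (Dk w) f) z + c * hol_lift (\<lambda>g z. E' z * g z) f z"
proof (cases "f holomorphic_on UHP \<and> z \<in> UHP")
  case True
  have 1: "(\<lambda>z. if z \<in> UHP then E z * f z else 0) holomorphic_on UHP"
    using True assms(1) holomorphic_UHP_cong[of "\<lambda>z. if z \<in> UHP then E z * f z else 0" "\<lambda>z. E z * f z"]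
    by (auto intro: holomorphic_intros)
  have 2: "(\<lambda>z. if z \<in> UHP then Dk w f z else 0) holomorphic_on UHP"
    using True holomorphic_UHP_cong[of "\<lambda>z. if z \<in> UHP then Dk w f z else 0" "Dk w f"]
      holomorphic_gen_fun[of f Gdelta w] by auto
  have "Dk l (\<lambda>z. if z \<in> UHP then E z * f z else 0) z = Dk l (\<lambda>z. E z * f z) z"
    using gen_fun_cong[of "\<lambda>z. if z \<in> UHP then E z * f z else 0" "\<lambda>z. E z * f z" z Gdelta l] True by simp
  also have "\<dots> = Dk k E z * f z + E z * Dk w f z"
    using True assms(1) unfolding assms(3) by (intro Dk_mult) auto
  also have "\<dots> = E z * Dk w f z + c * (E' z * f z)"
    using True assms(2) by (simp add: algebra_simps)
  finally show ?thesis using True 1 2 by (simp add: hol_lift_def)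
next
  case False
  have "Dk l (\<lambda>z. 0) z = 0" for z using gen_fun_zero[of Gdelta] by simp
  then show ?thesis using False by (auto simp: hol_lift_def)
qed

lemma delta_e4: "delta_op \<circ> e4_op = (e4_op \<circ> delta_op) + oscal (- (1 / 3)) e6_op"
proof (intro ext)
  fix F w z
  show "(delta_op \<circ> e4_op) F w z = ((e4_op \<circ> delta_op) + oscal (- (1 / 3)) e6_op) F w z"
    using hol_lift_Dk_hol_lift_mult[of E4 4 "- (1 / 3)" E6 "w - 2" "w - 6" "F (w - 6)" z]
    by (simp add: delta_op_def e4_op_def e6_op_def fam_apply scal_apply holomorphic_E Dk_E4)
qed

lemma delta_e6: "delta_op \<circ> e6_op = (e6_op \<circ> delta_op) + oscal (- (1 / 2)) (e4_op \<circ> e4_op)"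
proof (intro ext)
  fix F w z
  have "hol_lift (\<lambda>g z. E4 z * g z) (hol_lift (\<lambda>g z. E4 z * g z) f) z = hol_lift (\<lambda>g z. E4 z ^ 2 * g z) f z" for f
    using holomorphic_hol_lift[of Ge4 0 f] by (auto simp: hol_lift_def power2_eq_square)
  then show "(delta_op \<circ> e6_op) F w z = ((e6_op \<circ> delta_op) + oscal (- (1 / 2)) (e4_op \<circ> e4_op)) F w z"
    using hol_lift_Dk_hol_lift_mult[of E6 6 "- (1 / 2)" "\<lambda>z. E4 z ^ 2" "w - 2" "w - 8" "F (w - 8)" z]
    by (simp add: delta_op_def e4_op_def e6_op_def fam_apply scal_apply holomorphic_E Dk_E6)
qed

lemma e4_e6_commute: "e4_op \<circ> e6_op = e6_op \<circ> e4_op"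
proof (intro ext)
  fix F w z
  have "hol_lift (\<lambda>g z. E4 z * g z) (hol_lift (\<lambda>g z. E6 z * g z) f) z =
      hol_lift (\<lambda>g z. E6 z * g z) (hol_lift (\<lambda>g z. E4 z * g z) f) z" for f
    using holomorphic_hol_lift[of Ge4 0 f] holomorphic_hol_lift[of Ge6 0 f] by (auto simp: hol_lift_def)
  then show "(e4_op \<circ> e6_op) F w z = (e6_op \<circ> e4_op) F w z"
    by (simp add: e4_op_def e6_op_def)
qed

lemma MW_word: "set u \<subseteq> {Ge4, Ge6} \<Longrightarrow> word_op u \<in> MW (real (word_wt u))"
  unfolding MW_def by (rule span_words_word) auto

lemma MW_RW: "A \<in> MW k \<Longrightarrow> A \<in> RW k"
  using MW_subset_RW by blast

lemma MW_induct [consumes 1, case_names zero add]: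
  assumes "A \<in> MW k" and "P 0"
    and "\<And>A c u. A \<in> MW k \<Longrightarrow> P A \<Longrightarrow> set u \<subseteq> {Ge4, Ge6} \<Longrightarrow> real (word_wt u) = k \<Longrightarrow> P (A + oscal c (word_op u))"
  shows "P A"
  using assms(1) unfolding MW_def
proof (induction rule: span_words_induct)
  case zero
  show ?case by (rule assms(2))
next
  case (add A c u)
  then show ?case unfolding MW_def[symmetric] by (intro assms(3)) auto
qed

lemma word_op_commute:
  assumes "set u \<subseteq> {Ge4, Ge6}" "set v \<subseteq> {Ge4, Ge6}"
  shows "word_op u \<circ> word_op v = word_op v \<circ> word_op u"
proof -
  have gen: "gen_op g \<circ> gen_op h = gen_op h \<circ> gen_op g" if "g \<in> {Ge4, Ge6}" "h \<in> {Ge4, Ge6}" for g h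
    using that e4_e6_commute by auto
  have word: "gen_op g \<circ> word_op v = word_op v \<circ> gen_op g" if "g \<in> {Ge4, Ge6}" "set v \<subseteq> {Ge4, Ge6}" for g v
    using that(2)
  proof (induction v)
    case (Cons h v)
    then have "h \<in> {Ge4, Ge6}" "set v \<subseteq> {Ge4, Ge6}" by auto
    from gen[OF that(1) this(1)] Cons.IH[OF this(2)] show ?case unfolding word_op_Cons by (metis o_assoc)
  qed auto
  show ?thesis using assms(1)
  proof (induction u)
    case (Cons g u)
    then have "g \<in> {Ge4, Ge6}" "set u \<subseteq> {Ge4, Ge6}" by auto
    from word[OF this(1) assms(2)] Cons.IH[OF this(2)] show ?case unfolding word_op_Cons by (metis o_assoc)
  qed auto
qed

lemma MW_commute:
  assumes A: "A \<in> MW k" and B: "B \<in> MW l"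
  shows "A \<circ> B = B \<circ> A"
proof -
  have word: "word_op u \<circ> B = B \<circ> word_op u" if u: "set u \<subseteq> {Ge4, Ge6}" for u
    using B
  proof (induction rule: MW_induct)
    case zero
    then show ?case using RW_comp_zero[OF MW_RW[OF MW_word[OF u]]] by (simp only: zero_comp)
  next
    case (add B c v)
    note U = MW_RW[OF MW_word[OF u]]
    have "word_op v \<in> RW l" using MW_RW[OF MW_word[OF add.hyps(2)]] add.hyps(3) by simp
    then show ?case
      by (simp only: RW_comp_add[OF U MW_RW[OF add.hyps(1)] RW_oscal] RW_comp_oscal[OF U]
        comp_add_distrib_right comp_oscal_left word_op_commute[OF u add.hyps(2)] add.IH)
  qed
  show ?thesis using A
  proof (induction rule: MW_induct)
    case zero
    then show ?case using RW_comp_zero[OF MW_RW[OF B]] by (simp only: zero_comp)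
  next
    case (add A c u)
    have "word_op u \<in> RW k" using MW_RW[OF MW_word[OF add.hyps(2)]] add.hyps(3) by simp
    then show ?case
      by (simp only: RW_comp_add[OF MW_RW[OF B] MW_RW[OF add.hyps(1)] RW_oscal] RW_comp_oscal[OF MW_RW[OF B]]
        comp_add_distrib_right comp_oscal_left word[OF add.hyps(2)] add.IH)
  qed
qed

lemma delta_word:
  assumes "set u \<subseteq> {Ge4, Ge6}"
  shows "\<exists>f' \<in> MW (real (word_wt u) + 2). delta_op \<circ> word_op u = (word_op u \<circ> delta_op) + f'"
  using assms
proof (induction u)
  case Nil
  have "delta_op \<circ> word_op [] = (word_op [] \<circ> delta_op) + 0" by simp
  then show ?case using MW_zero by blast
next
  case (Cons g u)
  let ?W = "word_op u"
  have u: "set u \<subseteq> {Ge4, Ge6}" and g: "g \<in> {Ge4, Ge6}" using Cons.prems by auto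
  have gM: "gen_op g \<in> MW (real (gen_wt g))" using MW_word[of "[g]"] g by (simp add: word_op_Cons)
  have "e6_op \<in> MW 6" "e4_op \<circ> e4_op \<in> MW 8"
    using MW_word[of "[Ge6]"] MW_word[of "[Ge4, Ge4]"] by (simp_all add: word_op_Cons)
  then have "\<exists>G \<in> MW (real (gen_wt g) + 2). delta_op \<circ> gen_op g = (gen_op g \<circ> delta_op) + G"
    using g delta_e4 delta_e6 MW_oscal by fastforce
  then obtain G where G: "G \<in> MW (real (gen_wt g) + 2)" "delta_op \<circ> gen_op g = (gen_op g \<circ> delta_op) + G"
    by blast
  obtain f' where f': "f' \<in> MW (real (word_wt u) + 2)" "delta_op \<circ> ?W = (?W \<circ> delta_op) + f'"
    using Cons.IH[OF u] by blast
  have W: "?W \<circ> delta_op \<in> RW (real (word_wt u) + 2)"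
    using RW_comp[OF MW_RW[OF MW_word[OF u]] delta_in_RW] .
  have "delta_op \<circ> word_op (g # u) = (delta_op \<circ> gen_op g) \<circ> ?W"
    by (simp only: word_op_Cons o_assoc)
  also have "\<dots> = (gen_op g \<circ> (delta_op \<circ> ?W)) + (G \<circ> ?W)"
    by (simp only: G(2) comp_add_distrib_right o_assoc)
  also have "gen_op g \<circ> (delta_op \<circ> ?W) = (gen_op g \<circ> (?W \<circ> delta_op)) + (gen_op g \<circ> f')"
    by (simp only: f'(2) RW_comp_add[OF MW_RW[OF gM] W MW_RW[OF f'(1)]])
  finally have "delta_op \<circ> word_op (g # u) =
      (word_op (g # u) \<circ> delta_op) + ((gen_op g \<circ> f') + (G \<circ> ?W))"
    by (simp only: word_op_Cons o_assoc add.assoc)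
  moreover have "gen_op g \<circ> f' \<in> MW (real (word_wt (g # u)) + 2)" "G \<circ> ?W \<in> MW (real (word_wt (g # u)) + 2)"
    using MW_comp[OF gM f'(1)] MW_comp[OF G(1) MW_word[OF u]] by (simp_all add: algebra_simps)
  ultimately show ?case using MW_add by blast
qed

text \<open>\<open>f'\<close> is multiplication by the Serre derivative of the form
  \<open>f\<close>. So \<open>delta_op\<close> induces a derivation of weight 2 on modular forms,
  and the whole ring is a skew polynomial ring over them.\<close>

lemma delta_MW:
  assumes "f \<in> MW k"
  shows "\<exists>f' \<in> MW (k + 2). delta_op \<circ> f = (f \<circ> delta_op) + f'"
  using assms
proof (induction rule: MW_induct)
  case zero
  have "delta_op \<circ> 0 = (0 \<circ> delta_op) + (0 :: hop)"
    using RW_comp_zero[OF delta_in_RW] by (simp only: zero_comp add_0_right)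
  then show ?case using MW_zero by blast
next
  case (add A c u)
  then obtain A' where A': "A' \<in> MW (k + 2)" "delta_op \<circ> A = (A \<circ> delta_op) + A'" by blast
  obtain U where U: "U \<in> MW (k + 2)" "delta_op \<circ> word_op u = (word_op u \<circ> delta_op) + U"
    using delta_word[OF add.hyps(2)] add.hyps(3) by blast
  have "word_op u \<in> RW k" using MW_RW[OF MW_word[OF add.hyps(2)]] add.hyps(3) by simp
  then have "delta_op \<circ> (A + oscal c (word_op u)) = (delta_op \<circ> A) + oscal c (delta_op \<circ> word_op u)"
    by (simp only: RW_comp_add[OF delta_in_RW MW_RW[OF add.hyps(1)] RW_oscal] RW_comp_oscal[OF delta_in_RW])
  also have "\<dots> = ((A + oscal c (word_op u)) \<circ> delta_op) + (A' + oscal c U)"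
    by (simp only: A'(2) U(2) oscal_add comp_add_distrib_right comp_oscal_left add_ac)
  finally show ?case using A' U MW_add MW_oscal by blast
qed

text \<open>Weight \<open>k\<close> and order less than \<open>N\<close>, with only 0 at
  \<open>N = 0\<close>. As the coefficient of \<open>delta_op ^^ N\<close> is tied to weight
  \<open>k - 2 * real N\<close>, weights are tracked together with orders. Coefficients may vanish,
  so \<open>N\<close> is only a bound.\<close>

fun ordlt :: "real \<Rightarrow> nat \<Rightarrow> hop set" where
  "ordlt k 0 = {0}"
| "ordlt k (Suc N) = {(f \<circ> (delta_op ^^ N)) + A | f A. f \<in> MW (k - 2 * real N) \<and> A \<in> ordlt k N}"

lemma ordlt_cong: "A \<in> ordlt k N \<Longrightarrow> k = l \<Longrightarrow> N = M \<Longrightarrow> A \<in> ordlt l M"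
  by simp

lemma MW_cong: "A \<in> MW k \<Longrightarrow> k = l \<Longrightarrow> A \<in> MW l"
  by simp

lemma RW_cong: "A \<in> RW k \<Longrightarrow> k = l \<Longrightarrow> A \<in> RW l"
  by simp

lemma ordlt_SucI: "f \<in> MW (k - 2 * real N) \<Longrightarrow> A \<in> ordlt k N \<Longrightarrow> (f \<circ> (delta_op ^^ N)) + A \<in> ordlt k (Suc N)"
  by auto

lemma monomial_RW: "f \<in> MW (k - 2 * real N) \<Longrightarrow> f \<circ> (delta_op ^^ N) \<in> RW k"
  using RW_comp[OF MW_RW delta_power_in_RW, of f "k - 2 * real N" N] by simp

lemma ordlt_RW: "A \<in> ordlt k N \<Longrightarrow> A \<in> RW k"
  by (induction N arbitrary: A) (auto intro: RW_zero RW_add monomial_RW)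

lemma ordlt_zero: "0 \<in> ordlt k N"
proof (induction N)
  case (Suc N)
  from ordlt_SucI[OF MW_zero Suc] show ?case by (simp only: zero_comp add_0)
qed auto

lemma ordlt_Suc: "A \<in> ordlt k N \<Longrightarrow> A \<in> ordlt k (Suc N)"
  using ordlt_SucI[OF MW_zero, of A k N] by (simp only: zero_comp add_0)

lemma ordlt_mono: "N \<le> M \<Longrightarrow> A \<in> ordlt k N \<Longrightarrow> A \<in> ordlt k M"
  by (induction M rule: dec_induct) (auto simp del: ordlt.simps intro: ordlt_Suc)

lemma ordlt_monomial: "f \<in> MW (k - 2 * real N) \<Longrightarrow> f \<circ> (delta_op ^^ N) \<in> ordlt k (Suc N)"
  using ordlt_SucI[OF _ ordlt_zero, of f k N] by (simp only: add_0_right)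

lemma ordlt_add: "A \<in> ordlt k N \<Longrightarrow> B \<in> ordlt k N \<Longrightarrow> A + B \<in> ordlt k N"
proof (induction N arbitrary: A B)
  case (Suc N)
  then obtain f A' g B' where *: "A = (f \<circ> (delta_op ^^ N)) + A'" "B = (g \<circ> (delta_op ^^ N)) + B'"
    "f \<in> MW (k - 2 * real N)" "g \<in> MW (k - 2 * real N)" "A' \<in> ordlt k N" "B' \<in> ordlt k N" by auto
  have "A + B = ((f + g) \<circ> (delta_op ^^ N)) + (A' + B')"
    unfolding * by (simp only: comp_add_distrib_right add_ac)
  then show ?case using Suc.IH * MW_add by (simp only: ordlt_SucI)
qed auto

lemma ordlt_oscal: "A \<in> ordlt k N \<Longrightarrow> oscal c A \<in> ordlt k N"
proof (induction N arbitrary: A)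
  case (Suc N)
  then obtain f A' where *: "A = (f \<circ> (delta_op ^^ N)) + A'"
    "f \<in> MW (k - 2 * real N)" "A' \<in> ordlt k N" by auto
  have "oscal c A = (oscal c f \<circ> (delta_op ^^ N)) + oscal c A'"
    unfolding * by (simp only: comp_oscal_left oscal_add)
  then show ?case using Suc.IH * MW_oscal by (simp only: ordlt_SucI)
qed auto

lemma ordlt_diff: "A \<in> ordlt k N \<Longrightarrow> B \<in> ordlt k N \<Longrightarrow> A - B \<in> ordlt k N"
  by (simp only: op_diff_conv ordlt_add ordlt_oscal)

lemma ordlt_MW_comp: "g \<in> MW l \<Longrightarrow> A \<in> ordlt k N \<Longrightarrow> g \<circ> A \<in> ordlt (l + k) N"
proof (induction N arbitrary: A)
  case 0
  then show ?case using RW_comp_zero[OF MW_RW, of g l] by (simp only: ordlt.simps(1) singleton_iff)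
next
  case (Suc N)
  then obtain f A' where *: "A = (f \<circ> (delta_op ^^ N)) + A'"
    "f \<in> MW (k - 2 * real N)" "A' \<in> ordlt k N" by auto
  have "g \<circ> A = ((g \<circ> f) \<circ> (delta_op ^^ N)) + (g \<circ> A')"
    unfolding *(1) by (simp only: RW_comp_add[OF MW_RW[OF Suc.prems(1)] monomial_RW[OF *(2)] ordlt_RW[OF *(3)]] o_assoc)
  moreover have "g \<circ> f \<in> MW (l + k - 2 * real N)"
    by (rule MW_cong[OF MW_comp[OF Suc.prems(1) *(2)]]) simp
  ultimately show ?case using Suc.IH[OF Suc.prems(1) *(3)] by (simp only: ordlt_SucI)
qed

lemma ordlt_comp_delta: "A \<in> ordlt k N \<Longrightarrow> A \<circ> delta_op \<in> ordlt (k + 2) (Suc N)"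
proof (induction N arbitrary: A)
  case 0
  then show ?case using ordlt_zero[of "k + 2" "Suc 0"] by (simp only: ordlt.simps(1) singleton_iff zero_comp)
next
  case (Suc N)
  then obtain f A' where *: "A = (f \<circ> (delta_op ^^ N)) + A'"
    "f \<in> MW (k - 2 * real N)" "A' \<in> ordlt k N" by auto
  have "A \<circ> delta_op = (f \<circ> (delta_op ^^ Suc N)) + (A' \<circ> delta_op)"
    unfolding *(1) by (simp only: comp_add_distrib_right funpow_Suc_right o_assoc)
  moreover have "f \<in> MW (k + 2 - 2 * real (Suc N))" using *(2) by (simp add: algebra_simps)
  ultimately show ?case using Suc.IH[OF *(3)] by (simp only: ordlt_SucI)
qed

lemma ordlt_comp_delta_power: "A \<in> ordlt k N \<Longrightarrow> A \<circ> (delta_op ^^ j) \<in> ordlt (k + 2 * real j) (N + j)"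
proof (induction j)
  case (Suc j)
  have "(A \<circ> (delta_op ^^ j)) \<circ> delta_op \<in> ordlt (k + 2 * real (Suc j)) (N + Suc j)"
    by (rule ordlt_cong[OF ordlt_comp_delta[OF Suc.IH[OF Suc.prems]]]) auto
  then show ?case by (simp only: funpow_Suc_right o_assoc)
qed auto

text \<open>Moving \<open>delta_op\<close> past the leading coefficient adds a term
  \<open>f' \<circ> (delta_op ^^ N)\<close>, one order below the new leading term.\<close>

lemma ordlt_delta_comp: "A \<in> ordlt k N \<Longrightarrow> delta_op \<circ> A \<in> ordlt (k + 2) (Suc N)"
proof (induction N arbitrary: A)
  case 0
  then show ?case using ordlt_zero[of "k + 2" "Suc 0"] RW_comp_zero[OF delta_in_RW]
    by (simp only: ordlt.simps(1) singleton_iff)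
next
  case (Suc N)
  then obtain f A' where *: "A = (f \<circ> (delta_op ^^ N)) + A'"
    "f \<in> MW (k - 2 * real N)" "A' \<in> ordlt k N" by auto
  obtain f' where f': "f' \<in> MW (k - 2 * real N + 2)" "delta_op \<circ> f = (f \<circ> delta_op) + f'"
    using delta_MW[OF *(2)] by blast
  have "delta_op \<circ> A = ((delta_op \<circ> f) \<circ> (delta_op ^^ N)) + (delta_op \<circ> A')"
    unfolding *(1) by (simp only: RW_comp_add[OF delta_in_RW monomial_RW[OF *(2)] ordlt_RW[OF *(3)]] o_assoc)
  also have "\<dots> = (f \<circ> (delta_op ^^ Suc N)) + ((f' \<circ> (delta_op ^^ N)) + (delta_op \<circ> A'))"
    by (simp only: f'(2) comp_add_distrib_right funpow.simps o_assoc add.assoc)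
  finally have "delta_op \<circ> A = (f \<circ> (delta_op ^^ Suc N)) + ((f' \<circ> (delta_op ^^ N)) + (delta_op \<circ> A'))" .
  moreover have "f \<in> MW (k + 2 - 2 * real (Suc N))" using *(2) by (simp add: algebra_simps)
  moreover have "f' \<circ> (delta_op ^^ N) \<in> ordlt (k + 2) (Suc N)"
    using f'(1) by (intro ordlt_monomial) (simp add: algebra_simps)
  ultimately show ?case using Suc.IH[OF *(3)] by (simp only: ordlt_SucI ordlt_add)
qed

lemma ordlt_delta_power_comp: "A \<in> ordlt k N \<Longrightarrow> (delta_op ^^ j) \<circ> A \<in> ordlt (k + 2 * real j) (N + j)"
proof (induction j)
  case (Suc j)
  have "delta_op \<circ> ((delta_op ^^ j) \<circ> A) \<in> ordlt (k + 2 * real (Suc j)) (N + Suc j)"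
    by (rule ordlt_cong[OF ordlt_delta_comp[OF Suc.IH[OF Suc.prems]]]) auto
  then show ?case by (simp only: funpow.simps o_assoc)
qed auto

lemma delta_power_MW:
  assumes "f \<in> MW l"
  shows "\<exists>X \<in> ordlt (l + 2 * real p) p. (delta_op ^^ p) \<circ> f = (f \<circ> (delta_op ^^ p)) + X"
proof (induction p)
  case 0
  then show ?case by simp
next
  case (Suc p)
  then obtain X where X: "X \<in> ordlt (l + 2 * real p) p" "(delta_op ^^ p) \<circ> f = (f \<circ> (delta_op ^^ p)) + X" by blast
  obtain f' where f': "f' \<in> MW (l + 2)" "delta_op \<circ> f = (f \<circ> delta_op) + f'"
    using delta_MW[OF assms] by blast
  have f: "f \<in> MW (l + 2 * real p - 2 * real p)" using assms by simp
  have "(delta_op ^^ Suc p) \<circ> f = delta_op \<circ> ((delta_op ^^ p) \<circ> f)" by (simp only: funpow.simps o_assoc)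
  also have "\<dots> = ((delta_op \<circ> f) \<circ> (delta_op ^^ p)) + (delta_op \<circ> X)"
    by (simp only: X(2) RW_comp_add[OF delta_in_RW monomial_RW[OF f] ordlt_RW[OF X(1)]] o_assoc)
  also have "\<dots> = (f \<circ> (delta_op ^^ Suc p)) + ((f' \<circ> (delta_op ^^ p)) + (delta_op \<circ> X))"
    by (simp only: f'(2) comp_add_distrib_right funpow.simps o_assoc add.assoc)
  finally have "(delta_op ^^ Suc p) \<circ> f =
      (f \<circ> (delta_op ^^ Suc p)) + ((f' \<circ> (delta_op ^^ p)) + (delta_op \<circ> X))" .
  moreover have "f' \<circ> (delta_op ^^ p) \<in> ordlt (l + 2 * real (Suc p)) (Suc p)"
    using f'(1) by (intro ordlt_monomial) (simp add: algebra_simps)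
  moreover have "delta_op \<circ> X \<in> ordlt (l + 2 * real (Suc p)) (Suc p)"
    by (rule ordlt_cong[OF ordlt_delta_comp[OF X(1)]]) auto
  ultimately show ?case using ordlt_add by blast
qed

text \<open>Orders at most \<open>p - 1\<close> and at most \<open>r\<close> add up to less than
  \<open>p + r\<close>; in terms of strict bounds the second factor therefore carries
  \<open>Suc r\<close>.\<close>

lemma ordlt_comp:
  "A \<in> ordlt k p \<Longrightarrow> B \<in> ordlt l (Suc r) \<Longrightarrow> A \<circ> B \<in> ordlt (k + l) (p + r)"
proof (induction p arbitrary: A)
  case 0
  then show ?case using ordlt_zero[of "k + l" "0 + r"] by (simp only: ordlt.simps(1) singleton_iff zero_comp)
next
  case (Suc p)
  then obtain f A' where *: "A = (f \<circ> (delta_op ^^ p)) + A'"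
    "f \<in> MW (k - 2 * real p)" "A' \<in> ordlt k p" by auto
  have "A \<circ> B = (f \<circ> ((delta_op ^^ p) \<circ> B)) + (A' \<circ> B)"
    unfolding *(1) by (simp only: comp_add_distrib_right o_assoc)
  moreover have "f \<circ> ((delta_op ^^ p) \<circ> B) \<in> ordlt (k + l) (Suc p + r)"
    by (rule ordlt_cong[OF ordlt_MW_comp[OF *(2) ordlt_delta_power_comp[OF Suc.prems(2), of p]]]) auto
  moreover have "A' \<circ> B \<in> ordlt (k + l) (Suc p + r)"
    using Suc.IH[OF *(3) Suc.prems(2)] by (rule ordlt_mono[rotated]) simp
  ultimately show ?case by (simp only: ordlt_add)
qed

text \<open>Modulo lower order, powers of \<open>delta_op\<close> commute with coefficients, so
  leading coefficients multiply. The error \<open>X\<close> collects the term from moving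
  \<open>delta_op ^^ p\<close> past \<open>\<beta>\<close> and the two tails.\<close>

lemma leading_comp:
  assumes a: "\<alpha> \<in> MW (k - 2 * real p)" "A \<in> ordlt k p"
    and b: "\<beta> \<in> MW (l - 2 * real r)" "B \<in> ordlt l r"
  shows "\<exists>X \<in> ordlt (k + l) (p + r).
    ((\<alpha> \<circ> (delta_op ^^ p)) + A) \<circ> ((\<beta> \<circ> (delta_op ^^ r)) + B) = ((\<alpha> \<circ> \<beta>) \<circ> (delta_op ^^ (p + r))) + X"
proof -
  let ?b = "(\<beta> \<circ> (delta_op ^^ r)) + B"
  obtain Y where Y: "Y \<in> ordlt (l - 2 * real r + 2 * real p) p" "(delta_op ^^ p) \<circ> \<beta> = (\<beta> \<circ> (delta_op ^^ p)) + Y"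
    using delta_power_MW[OF b(1)] by blast
  have \<beta>: "\<beta> \<in> MW (l - 2 * real r + 2 * real p - 2 * real p)" using b(1) by simp
  have e1: "((\<alpha> \<circ> (delta_op ^^ p)) + A) \<circ> ?b = ((\<alpha> \<circ> (delta_op ^^ p)) \<circ> ?b) + (A \<circ> ?b)"
    by (rule comp_add_distrib_right)
  have e2: "(\<alpha> \<circ> (delta_op ^^ p)) \<circ> ?b =
      (\<alpha> \<circ> ((delta_op ^^ p) \<circ> \<beta>) \<circ> (delta_op ^^ r)) + (\<alpha> \<circ> (delta_op ^^ p) \<circ> B)"
    unfolding RW_comp_add[OF monomial_RW[OF a(1)] monomial_RW[OF b(1)] ordlt_RW[OF b(2)]]
    by (simp only: o_assoc)
  have e3: "\<alpha> \<circ> ((delta_op ^^ p) \<circ> \<beta>) = (\<alpha> \<circ> \<beta> \<circ> (delta_op ^^ p)) + (\<alpha> \<circ> Y)"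
    unfolding Y(2) RW_comp_add[OF MW_RW[OF a(1)] monomial_RW[OF \<beta>] ordlt_RW[OF Y(1)]]
    by (simp only: o_assoc)
  have e4: "\<alpha> \<circ> ((delta_op ^^ p) \<circ> \<beta>) \<circ> (delta_op ^^ r) =
      ((\<alpha> \<circ> \<beta>) \<circ> (delta_op ^^ (p + r))) + (\<alpha> \<circ> Y \<circ> (delta_op ^^ r))"
    unfolding e3 comp_add_distrib_right by (simp only: funpow_add o_assoc)
  have eq: "((\<alpha> \<circ> (delta_op ^^ p)) + A) \<circ> ?b = ((\<alpha> \<circ> \<beta>) \<circ> (delta_op ^^ (p + r))) +
      (((\<alpha> \<circ> Y \<circ> (delta_op ^^ r)) + (\<alpha> \<circ> (delta_op ^^ p) \<circ> B)) + (A \<circ> ?b))"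
    unfolding e1 e2 e4 by (simp only: add.assoc)
  have m1: "\<alpha> \<circ> Y \<circ> (delta_op ^^ r) \<in> ordlt (k + l) (p + r)"
    by (rule ordlt_cong[OF ordlt_comp_delta_power[OF ordlt_MW_comp[OF a(1) Y(1)], of r]]) auto
  have m2: "\<alpha> \<circ> (delta_op ^^ p) \<circ> B \<in> ordlt (k + l) (p + r)"
    unfolding comp_assoc
    by (rule ordlt_cong[OF ordlt_MW_comp[OF a(1) ordlt_delta_power_comp[OF b(2), of p]]]) auto
  have m3: "A \<circ> ?b \<in> ordlt (k + l) (p + r)"
    by (rule ordlt_comp[OF a(2) ordlt_SucI[OF b]])
  show ?thesis by (rule bexI[where x = "_ + _", OF eq ordlt_add[OF ordlt_add[OF m1 m2] m3]])
qed

lemma word_op_ordlt: "\<exists>N. word_op u \<in> ordlt (real (word_wt u)) N"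
proof (induction u)
  case Nil
  have "id \<circ> (delta_op ^^ 0) \<in> ordlt 0 (Suc 0)"
    by (rule ordlt_monomial) (simp add: id_in_MW)
  then have "word_op [] \<in> ordlt (real (word_wt [])) (Suc 0)" by (simp only: funpow.simps word_op_Nil word_wt_simps of_nat_0 id_o)
  then show ?case ..
next
  case (Cons g u)
  then obtain N where N: "word_op u \<in> ordlt (real (word_wt u)) N" by blast
  have "word_op (g # u) \<in> ordlt (real (word_wt (g # u))) (Suc N)"
  proof (cases "g = Gdelta")
    case True
    then show ?thesis using ordlt_delta_comp[OF N] by (simp add: word_op_Cons add.commute del: ordlt.simps)
  next
    case False
    then have "set [g] \<subseteq> {Ge4, Ge6}" by (cases g) auto
    from MW_word[OF this] have "gen_op g \<in> MW (real (gen_wt g))" by (simp add: word_op_Cons)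
    from ordlt_Suc[OF ordlt_MW_comp[OF this N]] show ?thesis by (simp add: word_op_Cons del: ordlt.simps)
  qed
  then show ?case ..
qed

text \<open>Existence of expansions: a word is built by multiplying letters on the left, and each
  letter raises the bound on the order by at most one.\<close>

lemma RW_ordlt:
  assumes "A \<in> RW k"
  shows "\<exists>N. A \<in> ordlt k N"
  using assms unfolding RW_def
proof (induction rule: span_words_induct)
  case zero
  then show ?case using ordlt_zero by blast
next
  case (add A c u)
  then obtain N M where "A \<in> ordlt k N" "word_op u \<in> ordlt k M" using word_op_ordlt by blast
  then have "A + oscal c (word_op u) \<in> ordlt k (max N M)"
    by (intro ordlt_add ordlt_oscal) (auto intro: ordlt_mono[rotated])
  then show ?case ..
qed

section \<open>Uniqueness of expansions\<close>

text \<open>A zero loses exactly one order: at \<open>z0\<close> the new cofactor is a nonzero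
  multiple of \<open>of_nat (Suc m) * h z0\<close>, since the terms with \<open>deriv h\<close> and
  with \<open>E2\<close> keep a further factor \<open>z - z0\<close>.\<close>

lemma delta_op_hsingle_vanishing:
  assumes z0: "z0 \<in> UHP" and g: "g holomorphic_on UHP" "h holomorphic_on UHP"
    "\<And>z. z \<in> UHP \<Longrightarrow> g z = (z - z0) ^ Suc m * h z" "h z0 \<noteq> 0"
  shows "\<exists>g' h'. delta_op (hsingle n g) = hsingle (n + 2) g' \<and> g' holomorphic_on UHP \<and> h' holomorphic_on UHP
    \<and> (\<forall>z\<in>UHP. g' z = (z - z0) ^ m * h' z) \<and> h' z0 \<noteq> 0"
proof -
  define g' where "g' = hol_lift (Dk n) g"
  define h' where "h' z = (of_nat (Suc m) * h z + (z - z0) * deriv h z) / (2 * of_real pi * \<i>)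
    - of_real n / 12 * E2 z * (z - z0) * h z" for z
  have "delta_op (hsingle n g) = hsingle (n + 2) g'"
    using gen_op_hsingle[of Gdelta n g] by (simp add: g'_def)
  moreover have "g' holomorphic_on UHP"
    using holomorphic_hol_lift[of Gdelta n g] by (simp add: g'_def)
  moreover have "h' holomorphic_on UHP"
    unfolding h'_def[abs_def] using g open_UHP by (intro holomorphic_intros holomorphic_E) auto
  moreover have "g' z = (z - z0) ^ m * h' z" if z: "z \<in> UHP" for z
  proof -
    have d: "(h has_field_derivative deriv h z) (at z)"
      by (rule holomorphic_derivI[OF g(2) open_UHP z])
    have "((\<lambda>z. z - z0) has_field_derivative 1) (at z)"
      by (auto intro!: derivative_eq_intros)
    from DERIV_mult[OF DERIV_power[OF this, of "Suc m"] d]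
    have "((\<lambda>z. (z - z0) ^ Suc m * h z) has_field_derivative
        of_nat (Suc m) * (z - z0) ^ m * h z + (z - z0) ^ Suc m * deriv h z) (at z)"
      by (rule DERIV_cong) (simp add: mult.commute)
    then have "(g has_field_derivative
        of_nat (Suc m) * (z - z0) ^ m * h z + (z - z0) ^ Suc m * deriv h z) (at z)"
      by (rule has_field_derivative_transform_within_open[OF _ open_UHP z]) (simp add: g(3))
    then have "deriv g z = of_nat (Suc m) * (z - z0) ^ m * h z + (z - z0) ^ Suc m * deriv h z"
      by (rule DERIV_imp_deriv)
    also have "\<dots> = (z - z0) ^ m * (of_nat (Suc m) * h z + (z - z0) * deriv h z)"
      by (simp add: algebra_simps)
    finally have D: "deriv g z = (z - z0) ^ m * (of_nat (Suc m) * h z + (z - z0) * deriv h z)" .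
    show ?thesis using z g(1)
      by (simp add: g'_def hol_lift_def Dk_def dq_def D g(3) h'_def right_diff_distrib)
  qed
  moreover have "h' z0 \<noteq> 0" using g(4) by (simp add: h'_def del: of_nat_Suc)
  ultimately show ?thesis by blast
qed

lemma delta_power_hsingle_vanishing:
  assumes z0: "z0 \<in> UHP" and "i \<le> N"
  shows "\<exists>g h. (delta_op ^^ i) (hsingle n (\<lambda>z. (z - z0) ^ N)) = hsingle (n + 2 * real i) g
    \<and> g holomorphic_on UHP \<and> h holomorphic_on UHP
    \<and> (\<forall>z\<in>UHP. g z = (z - z0) ^ (N - i) * h z) \<and> h z0 \<noteq> 0"
  using assms(2)
proof (induction i)
  case 0
  have "(\<lambda>z. (z - z0) ^ N) holomorphic_on UHP" "(\<lambda>z. 1) holomorphic_on UHP"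
    by (intro holomorphic_intros)+
  then show ?case by (intro exI[of _ "\<lambda>z. (z - z0) ^ N"] exI[of _ "\<lambda>z. 1"]) auto
next
  case (Suc i)
  then obtain g h where gh: "(delta_op ^^ i) (hsingle n (\<lambda>z. (z - z0) ^ N)) = hsingle (n + 2 * real i) g"
    "g holomorphic_on UHP" "h holomorphic_on UHP" "\<And>z. z \<in> UHP \<Longrightarrow> g z = (z - z0) ^ (N - i) * h z" "h z0 \<noteq> 0"
    by auto
  have "N - i = Suc (N - Suc i)" using Suc.prems by simp
  from delta_op_hsingle_vanishing[OF z0 gh(2,3) gh(4)[unfolded this] gh(5), of "n + 2 * real i"] gh(1)
  show ?case by (simp add: algebra_simps)
qed

text \<open>Applying the relation to \<open>(z - z0) ^ N\<close> isolates the leading coefficient at \<open>z0\<close>.\<close>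

lemma leading_coeff_eq_zero:
  assumes ds: "\<And>i. i \<le> N \<Longrightarrow> ds i \<in> Mring" and zero: "(\<Sum>i\<le>N. ds i \<circ> (delta_op ^^ i)) = 0"
  shows "ds N = 0"
proof (rule Mring_eq_zero[OF ds])
  fix k z0 assume z0: "z0 \<in> UHP"
  let ?F = "hsingle 0 (\<lambda>z. (z - z0) ^ N)"
  have "\<forall>i. \<exists>g h. i \<le> N \<longrightarrow> (delta_op ^^ i) ?F = hsingle (2 * real i) g \<and> g holomorphic_on UHP
      \<and> g z0 = (z0 - z0) ^ (N - i) * h z0 \<and> h z0 \<noteq> 0"
  proof (intro allI)
    fix i
    show "\<exists>g h. i \<le> N \<longrightarrow> (delta_op ^^ i) ?F = hsingle (2 * real i) g \<and> g holomorphic_on UHP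
      \<and> g z0 = (z0 - z0) ^ (N - i) * h z0 \<and> h z0 \<noteq> 0"
      using delta_power_hsingle_vanishing[OF z0, of i N 0] z0 by (simp only: add_0) blast
  qed
  then obtain g h where gh: "\<forall>i. i \<le> N \<longrightarrow> (delta_op ^^ i) ?F = hsingle (2 * real i) (g i) \<and> g i holomorphic_on UHP
      \<and> g i z0 = (z0 - z0) ^ (N - i) * h i z0 \<and> h i z0 \<noteq> 0"
    unfolding choice_iff by blast
  \<comment> \<open>For \<open>i < N\<close> the power of \<open>z0 - z0\<close> is 0, while
    \<open>0 ^ 0 = 1\<close> keeps the term \<open>i = N\<close>. The test function starts in weight
    0, so \<open>k + 2 * real N\<close> is where the part of \<open>ds N\<close> of weight
    \<open>k\<close> becomes visible.\<close>
  have *: "(ds i \<circ> (delta_op ^^ i)) ?F (k + 2 * real N) z0 =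
      (if N = i then symbol (ds N) k z0 * h N z0 else 0)" if "i \<le> N" for i
  proof -
    have "(ds i \<circ> (delta_op ^^ i)) ?F (k + 2 * real N) z0 = symbol (ds i) (k + 2 * real N - 2 * real i) z0 * g i z0"
      using gh that Mring_hsingle[OF ds[OF that] z0] by simp
    then show ?thesis using gh that by (cases "N = i") auto
  qed
  have "(\<Sum>i\<le>N. ds i \<circ> (delta_op ^^ i)) ?F (k + 2 * real N) z0 =
      (\<Sum>i\<le>N. if N = i then symbol (ds N) k z0 * h N z0 else 0)"
    unfolding sum_op_apply by (intro sum.cong refl *) simp
  then have "symbol (ds N) k z0 * h N z0 = 0" unfolding zero by (simp add: fam_apply)
  then show "symbol (ds N) k z0 = 0" using gh by simp
qed simp

section \<open>Order and leading coefficient\<close>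

lemma is_expansion_iff:
  "is_expansion a N cs \<longleftrightarrow> (\<forall>i\<le>N. cs i \<in> Mring) \<and> cs N \<noteq> 0 \<and> a = (\<Sum>i\<le>N. cs i \<circ> (delta_op ^^ i))"
proof -
  have "(\<lambda>F w z. \<Sum>i\<le>N. (cs i \<circ> (delta_op ^^ i)) F w z) = (\<Sum>i\<le>N. cs i \<circ> (delta_op ^^ i))"
    by (intro ext) (simp only: sum_op_apply)
  then show ?thesis unfolding is_expansion_def op_zero_eq by (simp only:)
qed

lemma oscal_sum: "oscal c (\<Sum>i\<in>I. A i) = (\<Sum>i\<in>I. oscal c (A i))"
  by (intro ext) (simp add: sum_op_apply scal_apply sum_distrib_left)

lemma Mring_zero: "0 \<in> Mring"
  unfolding Mring_def by (rule span_words_zero)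

text \<open>Padding the shorter expansion with zeros and subtracting gives a relation in powers of
  \<open>delta_op\<close>, so the leading coefficients agree; for \<open>N' < N\<close> this would
  make \<open>cs N\<close> zero.\<close>

lemma expansion_unique_le:
  assumes "is_expansion a N cs" "is_expansion a N' cs'" "N' \<le> N"
  shows "N = N' \<and> cs N = cs' N'"
proof -
  define e where "e i = (if i \<le> N' then cs' i else 0)" for i
  have cs: "\<And>i. i \<le> N \<Longrightarrow> cs i \<in> Mring" "cs N \<noteq> 0" "a = (\<Sum>i\<le>N. cs i \<circ> (delta_op ^^ i))"
    and cs': "\<And>i. i \<le> N' \<Longrightarrow> cs' i \<in> Mring" "a = (\<Sum>i\<le>N'. cs' i \<circ> (delta_op ^^ i))"
    using assms(1,2) unfolding is_expansion_iff by blast+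
  have e: "e i \<in> Mring" for i using cs' by (simp add: e_def Mring_zero)
  have "(\<Sum>i\<le>N. e i \<circ> (delta_op ^^ i)) = a"
    unfolding cs'(2) e_def using assms(3)
    by (intro sum.mono_neutral_cong_right) (auto simp only: zero_comp if_False atMost_iff finite_atMost split: if_splits)
  then have "(\<Sum>i\<le>N. (cs i - e i) \<circ> (delta_op ^^ i)) = 0"
    unfolding op_diff_conv comp_add_distrib_right comp_oscal_left sum.distrib
    using cs(3) by (simp only: oscal_sum[symmetric] op_diff_conv[symmetric] diff_self)
  then have "cs N - e N = 0"
    using cs(1) e by (intro leading_coeff_eq_zero[where ds = "\<lambda>i. cs i - e i"])
      (auto simp only: Mring_def intro: span_words_diff)
  then have "cs N = e N" by (simp only: right_minus_eq)
  show ?thesis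
  proof (cases "N = N'")
    case True
    then have "e N = cs' N'" by (simp only: e_def order_refl if_True)
    then show ?thesis using \<open>cs N = e N\<close> True by (simp only:)
  next
    case False
    then have "\<not> N \<le> N'" using assms(3) by simp
    then have "e N = 0" by (simp only: e_def if_False)
    then show ?thesis using \<open>cs N = e N\<close> cs(2) by metis
  qed
qed

lemma expansion_unique:
  "is_expansion a N cs \<Longrightarrow> is_expansion a N' cs' \<Longrightarrow> N = N' \<and> cs N = cs' N'"
  using expansion_unique_le[of a N cs N' cs'] expansion_unique_le[of a N' cs' N cs] by (metis nle_le)

lemma not_expansion_zero: "\<not> is_expansion 0 N cs"
  unfolding is_expansion_iff using leading_coeff_eq_zero[of N cs] by metis

lemma ordlt_expansion:
  "A \<in> ordlt k N \<Longrightarrow> \<exists>cs. (\<forall>i. cs i \<in> MW (k - 2 * real i)) \<and> A = (\<Sum>i<N. cs i \<circ> (delta_op ^^ i))"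
proof (induction N arbitrary: A)
  case 0
  then show ?case
    by (intro exI[of _ "\<lambda>_. 0"] conjI allI MW_zero) (simp only: ordlt.simps(1) singleton_iff lessThan_0 sum.empty)
next
  case (Suc N)
  then obtain f A' where *: "A = (f \<circ> (delta_op ^^ N)) + A'"
    "f \<in> MW (k - 2 * real N)" "A' \<in> ordlt k N" by auto
  obtain cs where cs: "\<And>i. cs i \<in> MW (k - 2 * real i)" "A' = (\<Sum>i<N. cs i \<circ> (delta_op ^^ i))"
    using Suc.IH[OF *(3)] by blast
  have "A = (\<Sum>i<Suc N. (cs(N := f)) i \<circ> (delta_op ^^ i))"
    unfolding *(1) cs(2) sum.lessThan_Suc fun_upd_same by (subst add.commute) (auto intro!: arg_cong2[where f = "(+)"] sum.cong)
  moreover have "\<forall>i. (cs(N := f)) i \<in> MW (k - 2 * real i)" using cs(1) *(2) by simp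
  ultimately show ?case by blast
qed

text \<open>The graded expansion is one of those over which \<open>ord\<close> and
  \<open>top\<close> are described. Uniqueness holds among all expansions with coefficients in
  \<open>Mring\<close>, so this one decides both.\<close>

lemma ord_top:
  assumes "\<alpha> \<in> MW (k - 2 * real N)" "\<alpha> \<noteq> 0" "A' \<in> ordlt k N" "A = (\<alpha> \<circ> (delta_op ^^ N)) + A'"
  shows "A \<noteq> 0" "ord A = ereal (real N)" "top A = \<alpha>"
proof -
  obtain cs where cs: "\<And>i. cs i \<in> MW (k - 2 * real i)" "A' = (\<Sum>i<N. cs i \<circ> (delta_op ^^ i))"
    using ordlt_expansion[OF assms(3)] by blast
  have "A = (\<Sum>i<Suc N. (cs(N := \<alpha>)) i \<circ> (delta_op ^^ i))"
    unfolding assms(4) cs(2) sum.lessThan_Suc fun_upd_same by (subst add.commute) (auto intro!: arg_cong2[where f = "(+)"] sum.cong)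
  moreover have "(cs(N := \<alpha>)) i \<in> Mring" for i
    using cs(1)[of i] assms(1) MW_subset_Mring by (cases "i = N") auto
  ultimately have E: "is_expansion A N (cs(N := \<alpha>))"
    unfolding is_expansion_iff lessThan_Suc_atMost using assms(2) by simp
  show "A \<noteq> 0" using E not_expansion_zero by blast
  moreover have "(THE N. \<exists>cs. is_expansion A N cs) = N"
    using E expansion_unique by (intro the_equality) blast+
  ultimately show "ord A = ereal (real N)" by (simp only: ord_def op_zero_eq if_False)
  show "top A = \<alpha>" unfolding top_def
  proof (rule the_equality)
    show "\<exists>N cs. is_expansion A N cs \<and> \<alpha> = cs N"
      by (rule exI[of _ N], rule exI, rule conjI[OF E]) (simp only: fun_upd_same)
    fix t assume "\<exists>N cs. is_expansion A N cs \<and> t = cs N"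
    then obtain N' cs' where "is_expansion A N' cs'" "t = cs' N'" by blast
    then show "t = \<alpha>" using expansion_unique[OF _ E] by (metis fun_upd_same)
  qed
qed

text \<open>Since coefficients in \<open>ordlt\<close> may vanish, one descends to the first nonzero
  one.\<close>

lemma ordlt_leading:
  "A \<in> ordlt k M \<Longrightarrow> A = 0 \<or> (\<exists>N<M. \<exists>\<alpha> \<in> MW (k - 2 * real N). \<exists>A' \<in> ordlt k N.
    \<alpha> \<noteq> 0 \<and> A = (\<alpha> \<circ> (delta_op ^^ N)) + A')"
proof (induction M arbitrary: A)
  case (Suc M)
  then obtain f A' where *: "A = (f \<circ> (delta_op ^^ M)) + A'"
    "f \<in> MW (k - 2 * real M)" "A' \<in> ordlt k M" by auto
  show ?case
  proof (cases "f = 0")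
    case True
    then have A: "A = A'" unfolding *(1) by (simp only: zero_comp add_0)
    from Suc.IH[OF *(3)] show ?thesis
    proof
      assume "\<exists>N<M. \<exists>\<alpha> \<in> MW (k - 2 * real N). \<exists>B \<in> ordlt k N. \<alpha> \<noteq> 0 \<and> A' = (\<alpha> \<circ> (delta_op ^^ N)) + B"
      then obtain N \<alpha> B where "N < M" "\<alpha> \<in> MW (k - 2 * real N)" "B \<in> ordlt k N" "\<alpha> \<noteq> 0"
        "A' = (\<alpha> \<circ> (delta_op ^^ N)) + B" by (elim exE conjE bexE) (rule that)
      then show ?thesis unfolding A
        by (intro disjI2 exI[of _ N] conjI bexI[of _ \<alpha>] bexI[of _ B] less_SucI)
    next
      assume "A' = 0"
      then show ?thesis by (intro disjI1) (simp only: A)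
    qed
  next
    case False
    then show ?thesis using *
      by (intro disjI2 exI[of _ M] conjI bexI[of _ f] bexI[of _ A'] lessI)
  qed
qed auto

lemma ord_ordlt:
  assumes "A \<in> ordlt k N"
  shows "ord A < ereal (real N)"
  using ordlt_leading[OF assms]
proof
  assume "A = 0"
  then show ?thesis by (simp add: ord_def op_zero_eq)
next
  assume "\<exists>M<N. \<exists>\<alpha> \<in> MW (k - 2 * real M). \<exists>A' \<in> ordlt k M. \<alpha> \<noteq> 0 \<and> A = (\<alpha> \<circ> (delta_op ^^ M)) + A'"
  then obtain M where "M < N" "ord A = ereal (real M)" using ord_top(2) by blast
  then show ?thesis by simp
qed

lemma RW_leading:
  assumes "A \<in> RW k" "ord A = ereal (of_int i)"
  shows "i \<ge> 0" "top A \<in> MW (k - 2 * real (nat i))" "top A \<noteq> 0"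
    "\<exists>A' \<in> ordlt k (nat i). A = (top A \<circ> (delta_op ^^ nat i)) + A'"
proof -
  have "A \<noteq> 0" using assms(2) by (auto simp: ord_def op_zero_eq)
  moreover obtain M where "A \<in> ordlt k M" using RW_ordlt[OF assms(1)] by blast
  ultimately obtain N \<alpha> A' where *: "\<alpha> \<in> MW (k - 2 * real N)" "A' \<in> ordlt k N" "\<alpha> \<noteq> 0"
    "A = (\<alpha> \<circ> (delta_op ^^ N)) + A'" using ordlt_leading by blast
  have "top A = \<alpha>" "ord A = ereal (real N)" using ord_top[OF *(1,3,2,4)] by auto
  moreover from this have "i = int N" using assms(2) by simp
  ultimately show "i \<ge> 0" "top A \<in> MW (k - 2 * real (nat i))" "top A \<noteq> 0"
    "\<exists>A' \<in> ordlt k (nat i). A = (top A \<circ> (delta_op ^^ nat i)) + A'"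
    using * by auto
qed

section \<open>Products of modular forms\<close>

lemma symbol_comp:
  assumes "A \<in> MW k" "B \<in> MW l" "z \<in> UHP"
  shows "symbol (A \<circ> B) (k + l) z = symbol A k z * symbol B l z"
proof -
  obtain h where h: "h holomorphic_on UHP" "B (hsingle 0 (\<lambda>z. 1)) = hsingle l h"
    using RW_hsingle[OF MW_RW[OF assms(2)], of "\<lambda>z. 1" 0] by auto
  then have "symbol B l = h" by (simp add: symbol_def)
  moreover have "symbol (A \<circ> B) (k + l) z = A (hsingle l h) (k + l) z" by (simp add: symbol_def h(2))
  ultimately show ?thesis
    using Mring_hsingle[OF _ assms(3) h(1), of A l "k + l"] assms(1) MW_subset_Mring by auto
qed

lemma MW_symbol:
  assumes "A \<in> MW k"
  shows "symbol A k holomorphic_on UHP" "w \<noteq> k \<Longrightarrow> symbol A w z = 0"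
proof -
  obtain h where h: "h holomorphic_on UHP" "A (hsingle 0 (\<lambda>z. 1)) = hsingle k h"
    using RW_hsingle[OF MW_RW[OF assms(1)], of "\<lambda>z. 1" 0] by auto
  then show "symbol A k holomorphic_on UHP" "w \<noteq> k \<Longrightarrow> symbol A w z = 0"
    by (simp_all add: symbol_def hsingle_def)
qed

lemma MW_eq_zero:
  assumes "A \<in> MW k" "\<And>z. z \<in> UHP \<Longrightarrow> symbol A k z = 0"
  shows "A = 0"
proof (rule Mring_eq_zero)
  show "A \<in> Mring" using assms(1) MW_subset_Mring by blast
  show "symbol A w z = 0" if "z \<in> UHP" for w z
    using assms(2)[OF that] MW_symbol(2)[OF assms(1)] by (cases "w = k") auto
qed

text \<open>If the product vanishes, the second symbol vanishes on the nonempty open set where the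
  first does not, and hence on all of the connected set \<open>UHP\<close> by analytic
  continuation.\<close>

lemma MW_comp_nonzero:
  assumes A: "A \<in> MW k" "A \<noteq> 0" and B: "B \<in> MW l" "B \<noteq> 0"
  shows "A \<circ> B \<noteq> 0"
proof
  assume "A \<circ> B = 0"
  then have zero: "symbol A k z * symbol B l z = 0" if "z \<in> UHP" for z
    using symbol_comp[OF A(1) B(1) that] by (simp add: symbol_def fam_apply)
  obtain z0 where z0: "z0 \<in> UHP" "symbol A k z0 \<noteq> 0" using MW_eq_zero A by blast
  note hol = MW_symbol(1)[OF A(1)] MW_symbol(1)[OF B(1)]
  define U where "U = {z \<in> UHP. symbol A k z \<noteq> 0}"
  have "open (UHP \<inter> symbol A k -` (- {0}))"
    using holomorphic_on_imp_continuous_on[OF hol(1)] open_UHP by (intro continuous_open_preimage) auto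
  moreover have "U = UHP \<inter> symbol A k -` (- {0})" by (auto simp: U_def)
  ultimately have U: "open U" "U \<noteq> {}" "U \<subseteq> UHP" using z0 by (auto simp: U_def)
  have "symbol B l z = 0" if "z \<in> UHP" for z
  proof (rule analytic_continuation_open[OF U(1) open_UHP U(2) connected_UHP U(3) hol(2)])
    show "(\<lambda>z. 0) holomorphic_on UHP" by (rule holomorphic_on_const)
    show "symbol B l z = 0" if "z \<in> U" for z using zero[of z] that by (auto simp: U_def)
  qed fact
  then show False using MW_eq_zero[OF B(1)] B(2) by blast
qed

lemma MW_power:
  assumes "A \<in> MW k"
  shows "A ^^ s \<in> MW (real s * k)"
proof (induction s)
  case 0
  then show ?case using id_in_MW by (simp only: funpow.simps of_nat_0 mult_zero_left)
next
  case (Suc s)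
  have "A \<circ> (A ^^ s) \<in> MW (real (Suc s) * k)"
    by (rule MW_cong[OF MW_comp[OF assms Suc]]) (simp add: algebra_simps)
  then show ?case by (simp only: funpow.simps)
qed

lemma MW_power_nonzero:
  assumes "A \<in> MW k" "A \<noteq> 0"
  shows "A ^^ s \<noteq> 0"
proof (induction s)
  case 0
  have "(id :: hop) (\<lambda>w z. 1) 0 0 \<noteq> (0 :: hop) (\<lambda>w z. 1) 0 0" by (simp add: fam_apply)
  then show ?case unfolding funpow.simps by metis
next
  case (Suc s)
  show ?case unfolding funpow.simps by (rule MW_comp_nonzero[OF assms MW_power[OF assms(1)] Suc])
qed

section \<open>Pseudo-division\<close>

text \<open>The multiplier \<open>\<gamma>\<close> is free because two choices occur:
  \<open>\<beta>\<close> in a general division step and the cofactor of the common divisor in the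
  first one. As coefficients commute, the single equation \<open>eq\<close> cancels the leading
  terms on both sides.\<close>

lemma cancel_leading:
  assumes A: "\<alpha> \<in> MW (n - 2 * real (J + s))" "A' \<in> ordlt n (J + s)" "A = (\<alpha> \<circ> (delta_op ^^ (J + s))) + A'"
    and b: "\<beta> \<in> MW (m - 2 * real J)" "b' \<in> ordlt m J" "b = (\<beta> \<circ> (delta_op ^^ J)) + b'"
    and \<gamma>: "\<gamma> \<in> MW g" and \<alpha>': "\<alpha>' \<in> MW (g + n - m - 2 * real s)" and eq: "\<gamma> \<circ> \<alpha> = \<alpha>' \<circ> \<beta>"
  shows "(\<gamma> \<circ> A) - (\<alpha>' \<circ> (delta_op ^^ s) \<circ> b) \<in> ordlt (g + n) (J + s)"
    and "(A \<circ> \<gamma>) - (b \<circ> (\<alpha>' \<circ> (delta_op ^^ s))) \<in> ordlt (g + n) (J + s)"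
proof -
  have \<gamma>0: "\<gamma> \<in> MW (g - 2 * real 0)" using \<gamma> by simp
  have pad: "(C \<circ> (delta_op ^^ j)) + 0 = C \<circ> (delta_op ^^ j)" for C :: hop and j by (rule add_0_right)
  have pad0: "(\<gamma> \<circ> (delta_op ^^ 0)) + 0 = \<gamma>" by (simp only: pad funpow.simps o_id add_0_right)
  have comm: "\<alpha> \<circ> \<gamma> = \<gamma> \<circ> \<alpha>" "\<beta> \<circ> \<alpha>' = \<alpha>' \<circ> \<beta>"
    by (rule MW_commute[OF A(1) \<gamma>], rule MW_commute[OF b(1) \<alpha>'])
  have diff: "(P + X) - (P + Y) = X - Y" for P X Y :: hop by simp
  obtain X where X: "X \<in> ordlt (g + n) (0 + (J + s))" "\<gamma> \<circ> A = ((\<gamma> \<circ> \<alpha>) \<circ> (delta_op ^^ (0 + (J + s)))) + X"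
    using leading_comp[OF \<gamma>0 ordlt_zero A(1,2)] unfolding pad0 A(3)[symmetric] by blast
  obtain Y where Y: "Y \<in> ordlt (g + n - m + m) (s + J)"
    "\<alpha>' \<circ> (delta_op ^^ s) \<circ> b = ((\<alpha>' \<circ> \<beta>) \<circ> (delta_op ^^ (s + J))) + Y"
    using leading_comp[OF \<alpha>' ordlt_zero b(1,2)] unfolding pad b(3)[symmetric] by blast
  obtain Z where Z: "Z \<in> ordlt (n + g) (J + s + 0)" "A \<circ> \<gamma> = ((\<alpha> \<circ> \<gamma>) \<circ> (delta_op ^^ (J + s + 0))) + Z"
    using leading_comp[OF A(1,2) \<gamma>0 ordlt_zero] unfolding pad0 A(3)[symmetric] by blast
  obtain W where W: "W \<in> ordlt (m + (g + n - m)) (J + s)"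
    "b \<circ> (\<alpha>' \<circ> (delta_op ^^ s)) = ((\<beta> \<circ> \<alpha>') \<circ> (delta_op ^^ (J + s))) + W"
    using leading_comp[OF b(1,2) \<alpha>' ordlt_zero] unfolding pad b(3)[symmetric] by blast
  have "X \<in> ordlt (g + n) (J + s)" "Y \<in> ordlt (g + n) (J + s)"
    "Z \<in> ordlt (g + n) (J + s)" "W \<in> ordlt (g + n) (J + s)"
    using ordlt_cong[OF X(1)] ordlt_cong[OF Y(1)] ordlt_cong[OF Z(1)] ordlt_cong[OF W(1)] by simp_all
  then show "(\<gamma> \<circ> A) - (\<alpha>' \<circ> (delta_op ^^ s) \<circ> b) \<in> ordlt (g + n) (J + s)"
    "(A \<circ> \<gamma>) - (b \<circ> (\<alpha>' \<circ> (delta_op ^^ s))) \<in> ordlt (g + n) (J + s)"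
    unfolding X(2) Y(2) Z(2) W(2) comm eq add_0 add_0_right add.commute[of s J] diff
    by (simp_all only: ordlt_diff)
qed

context
  fixes \<beta> b' b :: hop and m :: real and J :: nat
  assumes \<beta>: "\<beta> \<in> MW (m - 2 * real J)" and b': "b' \<in> ordlt m J" and b: "b = (\<beta> \<circ> (delta_op ^^ J)) + b'"
begin

lemma b_RW: "b \<in> RW m"
  unfolding b by (intro RW_add monomial_RW \<beta> ordlt_RW[OF b'])

lemma power_RW: "\<beta> ^^ s \<in> RW (real s * (m - 2 * real J))"
  by (rule MW_RW[OF MW_power[OF \<beta>]])

lemma left_step:
  assumes \<alpha>: "\<alpha> \<in> MW (w - m - 2 * real s)" and R: "R \<in> ordlt w (J + s)"
    and eq: "X - (\<alpha> \<circ> (delta_op ^^ s) \<circ> b) = R" "(\<beta> ^^ s) \<circ> R = (c \<circ> b) + c'"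
  shows "(\<beta> ^^ s) \<circ> X = (((((\<beta> ^^ s) \<circ> \<alpha>) \<circ> (delta_op ^^ s)) + c) \<circ> b) + c'"
proof -
  have mono: "\<alpha> \<circ> (delta_op ^^ s) \<circ> b \<in> RW w"
    by (rule RW_cong[OF RW_comp[OF monomial_RW[OF \<alpha>] b_RW]]) simp
  have X: "X = (\<alpha> \<circ> (delta_op ^^ s) \<circ> b) + R" using eq(1) by (simp only: diff_eq_eq add.commute)
  show ?thesis
    unfolding X RW_comp_add[OF power_RW mono ordlt_RW[OF R]] eq(2)
    by (simp only: comp_add_distrib_right o_assoc add.assoc)
qed

lemma right_step:
  assumes \<alpha>: "\<alpha> \<in> MW (w - m - 2 * real s)" and c: "c \<in> RW (w - m + real s * (m - 2 * real J))"
    and eq: "X - (b \<circ> (\<alpha> \<circ> (delta_op ^^ s))) = R" "R \<circ> (\<beta> ^^ s) = (b \<circ> c) + c'"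
  shows "X \<circ> (\<beta> ^^ s) = (b \<circ> (((\<alpha> \<circ> (delta_op ^^ s)) \<circ> (\<beta> ^^ s)) + c)) + c'"
proof -
  have mono: "(\<alpha> \<circ> (delta_op ^^ s)) \<circ> (\<beta> ^^ s) \<in> RW (w - m + real s * (m - 2 * real J))"
    by (rule RW_comp[OF monomial_RW[OF \<alpha>] power_RW])
  have X: "X = (b \<circ> (\<alpha> \<circ> (delta_op ^^ s))) + R" using eq(1) by (simp only: diff_eq_eq add.commute)
  show ?thesis
    unfolding X RW_comp_add[OF b_RW mono c] comp_add_distrib_right eq(2)
    by (simp only: o_assoc add.assoc)
qed

text \<open>In right division the powers of \<open>\<beta>\<close> arrive to the right of
  \<open>delta_op ^^ s\<close> and have to be moved to the left, where \<open>ordlt\<close> keeps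
  its coefficients.\<close>

lemma monomial_comp_power:
  assumes "\<alpha> \<in> MW (w - 2 * real s)"
  shows "\<exists>Y \<in> ordlt (w + real s * (m - 2 * real J)) s.
    (\<alpha> \<circ> (delta_op ^^ s)) \<circ> (\<beta> ^^ s) = ((\<alpha> \<circ> (\<beta> ^^ s)) \<circ> (delta_op ^^ s)) + Y"
proof -
  have "\<beta> ^^ s \<in> MW (real s * (m - 2 * real J) - 2 * real 0)" using MW_power[OF \<beta>] by simp
  from leading_comp[OF assms ordlt_zero this ordlt_zero] show ?thesis
    by (simp only: add_0_right funpow.simps o_id)
qed

text \<open>Each step spends one factor \<open>\<beta>\<close>, even when the coefficient to be
  cancelled is 0, so the exponent is exactly \<open>s\<close>, and each adds
  \<open>m - 2 * real J\<close> to the weight. For the same reason the order of the quotient is only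
  bounded here.\<close>

lemma left_division:
  "A \<in> ordlt n (J + s) \<Longrightarrow> \<exists>c \<in> ordlt (n - m + real s * (m - 2 * real J)) s.
    \<exists>c' \<in> ordlt (n + real s * (m - 2 * real J)) J. (\<beta> ^^ s) \<circ> A = (c \<circ> b) + c'"
proof (induction s arbitrary: A n)
  case 0
  have "(\<beta> ^^ 0) \<circ> A = (0 \<circ> b) + A" by (simp only: funpow.simps id_o zero_comp add_0)
  moreover have "A \<in> ordlt (n + real 0 * (m - 2 * real J)) J" using 0 by simp
  ultimately show ?case using ordlt_zero by blast
next
  case (Suc s)
  obtain \<alpha> A' where A: "\<alpha> \<in> MW (n - 2 * real (J + s))" "A' \<in> ordlt n (J + s)"
    "A = (\<alpha> \<circ> (delta_op ^^ (J + s))) + A'" using Suc.prems by auto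
  define R where "R = (\<beta> \<circ> A) - (\<alpha> \<circ> (delta_op ^^ s) \<circ> b)"
  have \<alpha>: "\<alpha> \<in> MW ((m - 2 * real J) + n - m - 2 * real s)" by (rule MW_cong[OF A(1)]) simp
  have R: "R \<in> ordlt ((m - 2 * real J) + n) (J + s)"
    unfolding R_def by (rule cancel_leading(1)[OF A \<beta> b' b \<beta> \<alpha> MW_commute[OF \<beta> A(1)]])
  from Suc.IH[OF this] obtain c c' where
    c: "c \<in> ordlt ((m - 2 * real J) + n - m + real s * (m - 2 * real J)) s" and
    c': "c' \<in> ordlt ((m - 2 * real J) + n + real s * (m - 2 * real J)) J" and
    eq: "(\<beta> ^^ s) \<circ> R = (c \<circ> b) + c'" by blast
  have "(\<beta> ^^ Suc s) \<circ> A = (((((\<beta> ^^ s) \<circ> \<alpha>) \<circ> (delta_op ^^ s)) + c) \<circ> b) + c'"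
    using left_step[OF \<alpha> R R_def[symmetric] eq] by (simp only: funpow_Suc_right comp_assoc)
  moreover have "(((\<beta> ^^ s) \<circ> \<alpha>) \<circ> (delta_op ^^ s)) + c \<in> ordlt (n - m + real (Suc s) * (m - 2 * real J)) (Suc s)"
  proof (rule ordlt_SucI)
    show "(\<beta> ^^ s) \<circ> \<alpha> \<in> MW (n - m + real (Suc s) * (m - 2 * real J) - 2 * real s)"
      by (rule MW_cong[OF MW_comp[OF MW_power[OF \<beta>] \<alpha>]]) (simp add: algebra_simps)
    show "c \<in> ordlt (n - m + real (Suc s) * (m - 2 * real J)) s"
      by (rule ordlt_cong[OF c]) (simp_all add: algebra_simps)
  qed
  moreover have "c' \<in> ordlt (n + real (Suc s) * (m - 2 * real J)) J"
    by (rule ordlt_cong[OF c']) (simp_all add: algebra_simps)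
  ultimately show ?case by blast
qed

lemma right_division:
  "A \<in> ordlt n (J + s) \<Longrightarrow> \<exists>c \<in> ordlt (n - m + real s * (m - 2 * real J)) s.
    \<exists>c' \<in> ordlt (n + real s * (m - 2 * real J)) J. A \<circ> (\<beta> ^^ s) = (b \<circ> c) + c'"
proof (induction s arbitrary: A n)
  case 0
  have "A \<circ> (\<beta> ^^ 0) = (b \<circ> 0) + A"
    by (simp only: funpow.simps o_id RW_comp_zero[OF b_RW] add_0)
  moreover have "A \<in> ordlt (n + real 0 * (m - 2 * real J)) J" using 0 by simp
  ultimately show ?case using ordlt_zero by blast
next
  case (Suc s)
  obtain \<alpha> A' where A: "\<alpha> \<in> MW (n - 2 * real (J + s))" "A' \<in> ordlt n (J + s)"
    "A = (\<alpha> \<circ> (delta_op ^^ (J + s))) + A'" using Suc.prems by auto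
  define R where "R = (A \<circ> \<beta>) - (b \<circ> (\<alpha> \<circ> (delta_op ^^ s)))"
  have \<alpha>: "\<alpha> \<in> MW ((m - 2 * real J) + n - m - 2 * real s)" by (rule MW_cong[OF A(1)]) simp
  have R: "R \<in> ordlt ((m - 2 * real J) + n) (J + s)"
    unfolding R_def by (rule cancel_leading(2)[OF A \<beta> b' b \<beta> \<alpha> MW_commute[OF \<beta> A(1)]])
  from Suc.IH[OF this] obtain c c' where
    c: "c \<in> ordlt ((m - 2 * real J) + n - m + real s * (m - 2 * real J)) s" and
    c': "c' \<in> ordlt ((m - 2 * real J) + n + real s * (m - 2 * real J)) J" and
    eq: "R \<circ> (\<beta> ^^ s) = (b \<circ> c) + c'" by blast
  have "A \<circ> (\<beta> ^^ Suc s) = (b \<circ> (((\<alpha> \<circ> (delta_op ^^ s)) \<circ> (\<beta> ^^ s)) + c)) + c'"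
    using right_step[OF \<alpha> ordlt_RW[OF c] R_def[symmetric] eq] by (simp only: funpow.simps comp_assoc)
  moreover have "((\<alpha> \<circ> (delta_op ^^ s)) \<circ> (\<beta> ^^ s)) + c \<in> ordlt (n - m + real (Suc s) * (m - 2 * real J)) (Suc s)"
  proof -
    obtain Y where Y: "Y \<in> ordlt ((m - 2 * real J) + n - m + real s * (m - 2 * real J)) s"
      "(\<alpha> \<circ> (delta_op ^^ s)) \<circ> (\<beta> ^^ s) = ((\<alpha> \<circ> (\<beta> ^^ s)) \<circ> (delta_op ^^ s)) + Y"
      using monomial_comp_power[OF \<alpha>] by blast
    have "\<alpha> \<circ> (\<beta> ^^ s) \<in> MW (((m - 2 * real J) + n - m + real s * (m - 2 * real J)) - 2 * real s)"
      by (rule MW_cong[OF MW_comp[OF \<alpha> MW_power[OF \<beta>]]]) simp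
    from ordlt_SucI[OF this ordlt_add[OF Y(1) c]]
    show ?thesis unfolding Y(2) add.assoc by (rule ordlt_cong) (simp_all add: algebra_simps)
  qed
  moreover have "c' \<in> ordlt (n + real (Suc s) * (m - 2 * real J)) J"
    by (rule ordlt_cong[OF c']) (simp_all add: algebra_simps)
  ultimately show ?case by blast
qed

end

theorem theorem3p10:
  fixes i j m n l :: int and a b d a' b' :: hop
  assumes "0 \<le> j" and "j \<le> i" and "0 \<le> m" and "0 \<le> n"
    and "a \<in> Rk (of_int n)" and "ord a = ereal (of_int i)"
    and "b \<in> Rk (of_int m)" and "ord b = ereal (of_int j)"
    and "d \<in> Mk (of_int l)"
    and "a' \<in> Mk (of_int (n - 2 * i - l))" and "b' \<in> Mk (of_int (m - 2 * j - l))"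
    and "top a = a' \<circ> d" and "top b = b' \<circ> d"
  shows "(\<exists>c c'. c \<in> Rk (of_int ((m - 2 * j) * (i - j + 1) - l - m + n)) \<and> ord c = ereal (of_int (i - j))
            \<and> c' \<in> Rk (of_int ((m - 2 * j) * (i - j + 1) - l + n)) \<and> ord c' < ereal (of_int j)
            \<and> (top b ^^ nat (i - j)) \<circ> b' \<circ> a = op_add (c \<circ> b) c')
       \<and> (\<exists>c c'. c \<in> Rk (of_int ((m - 2 * j) * (i - j + 1) - l - m + n)) \<and> ord c = ereal (of_int (i - j))
            \<and> c' \<in> Rk (of_int ((m - 2 * j) * (i - j + 1) - l + n)) \<and> ord c' < ereal (of_int j)
            \<and> a \<circ> (top b ^^ nat (i - j)) \<circ> b' = op_add (b \<circ> c) c')"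
proof -
  define J where "J = nat j"
  define s where "s = nat (i - j)"
  define e :: real where "e = of_int m - 2 * real J"
  \<comment> \<open>The weight of \<open>b' \<circ> a\<close>, from which the division by
    \<open>b\<close> starts after the first reduction.\<close>
  define w :: real where "w = of_int (m - 2 * j - l + n)"
  have ij: "nat i = J + s" "of_int j = real J" "of_int (i - j) = real s"
    using assms(1,2) by (auto simp: J_def s_def)
  have i_eq: "of_int i = real J + real s" using ij(2,3) by simp
  have e_eq: "of_int (m - 2 * j) = e" by (simp add: e_def ij)
  have p: "of_int ((m - 2 * j) * (i - j + 1) - l - m + n) = w - of_int m + real s * e"
    and q: "of_int ((m - 2 * j) * (i - j + 1) - l + n) = w + real s * e"
    unfolding w_def of_int_add of_int_diff of_int_mult
    by (simp_all add: e_def i_eq ij(2) algebra_simps)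
  obtain a1 where a: "top a \<in> MW (of_int n - 2 * real (J + s))" "top a \<noteq> 0" "a1 \<in> ordlt (of_int n) (J + s)"
    "a = (top a \<circ> (delta_op ^^ (J + s))) + a1"
    using RW_leading[OF assms(5)[unfolded Rk_eq] assms(6)] unfolding ij(1) by blast
  obtain b1 where b: "top b \<in> MW (of_int m - 2 * real J)" "top b \<noteq> 0" "b1 \<in> ordlt (of_int m) J"
    "b = (top b \<circ> (delta_op ^^ J)) + b1"
    using RW_leading[OF assms(7)[unfolded Rk_eq] assms(8)] unfolding J_def by blast
  have a': "a' \<in> MW (w - of_int m - 2 * real s)"
    by (rule MW_cong[OF assms(10)[unfolded Mk_eq]]) (simp add: w_def i_eq ij(2))
  have b': "b' \<in> MW (of_int (m - 2 * j - l))" using assms(11) unfolding Mk_eq .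
  have d: "d \<in> MW (of_int l)" using assms(9) unfolding Mk_eq .
  have w: "of_int (m - 2 * j - l) + of_int n = w" by (simp add: w_def)
  have comm: "b' \<circ> a' = a' \<circ> b'" by (rule MW_commute[OF b' a'])
  \<comment> \<open>Both sides are the product of \<open>a'\<close>, \<open>b'\<close> and
    \<open>d\<close>: multiplying by \<open>b'\<close> already matches the leading coefficients,
    where division without a common factor would multiply by \<open>top b\<close>.\<close>
  have eq: "b' \<circ> top a = a' \<circ> top b" unfolding assms(12,13) o_assoc comm ..
  have a'_nz: "a' \<noteq> 0" using a(2) unfolding assms(12) by (metis zero_comp)
  have pow: "top b ^^ s \<in> MW (real s * e)" unfolding e_def by (rule MW_power[OF b(1)])
  have pow_nz: "top b ^^ s \<noteq> 0" by (rule MW_power_nonzero[OF b(1,2)])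
  \<comment> \<open>The first step, on the left and on the right. The remainders have order below
    \<open>i = j + s\<close>, so \<open>s\<close> steps with multiplier \<open>top b\<close> finish
    the division.\<close>
  note cancel = cancel_leading[OF a(1,3,4) b(1,3,4) b' _ eq, unfolded w, OF a']
  have "\<exists>c c'. c \<in> RW (w - of_int m + real s * e) \<and> ord c = ereal (real s)
    \<and> c' \<in> RW (w + real s * e) \<and> ord c' < ereal (real J) \<and> (top b ^^ s) \<circ> b' \<circ> a = (c \<circ> b) + c'"
  proof -
    obtain c c' where c: "c \<in> ordlt (w - of_int m + real s * e) s" and c': "c' \<in> ordlt (w + real s * e) J"
      and E: "(top b ^^ s) \<circ> ((b' \<circ> a) - (a' \<circ> (delta_op ^^ s) \<circ> b)) = (c \<circ> b) + c'"
      using left_division[OF b(1,3,4) cancel(1)] unfolding e_def by blast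
    \<comment> \<open>The quotient of the first step sits in degree \<open>s\<close>, above the
      later part \<open>c\<close> of order less than \<open>s\<close>. Its coefficient is a product
      of nonzero forms, which fixes the order.\<close>
    let ?c = "(((top b ^^ s) \<circ> a') \<circ> (delta_op ^^ s)) + c"
    have lead: "(top b ^^ s) \<circ> a' \<in> MW (w - of_int m + real s * e - 2 * real s)"
      by (rule MW_cong[OF MW_comp[OF pow a']]) simp
    have "?c \<in> RW (w - of_int m + real s * e)" by (rule ordlt_RW[OF ordlt_SucI[OF lead c]])
    moreover have "ord ?c = ereal (real s)"
      by (rule ord_top(2)[OF lead MW_comp_nonzero[OF pow pow_nz a' a'_nz] c refl])
    moreover have "(top b ^^ s) \<circ> b' \<circ> a = (?c \<circ> b) + c'"
      using left_step[OF b(1,3,4) a' cancel(1) refl E] by (simp only: comp_assoc)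
    ultimately show ?thesis using ordlt_RW[OF c'] ord_ordlt[OF c'] by blast
  qed
  moreover have "\<exists>c c'. c \<in> RW (w - of_int m + real s * e) \<and> ord c = ereal (real s)
    \<and> c' \<in> RW (w + real s * e) \<and> ord c' < ereal (real J) \<and> a \<circ> (top b ^^ s) \<circ> b' = (b \<circ> c) + c'"
  proof -
    obtain c c' where c: "c \<in> ordlt (w - of_int m + real s * e) s" and c': "c' \<in> ordlt (w + real s * e) J"
      and E: "((a \<circ> b') - (b \<circ> (a' \<circ> (delta_op ^^ s)))) \<circ> (top b ^^ s) = (b \<circ> c) + c'"
      using right_division[OF b(1,3,4) cancel(2)] unfolding e_def by blast
    let ?c = "((a' \<circ> (delta_op ^^ s)) \<circ> (top b ^^ s)) + c"
    obtain Y where Y: "Y \<in> ordlt (w - of_int m + real s * e) s"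
      "(a' \<circ> (delta_op ^^ s)) \<circ> (top b ^^ s) = ((a' \<circ> (top b ^^ s)) \<circ> (delta_op ^^ s)) + Y"
      using monomial_comp_power[OF b(1,3,4) a'] unfolding e_def by blast
    have c_eq: "?c = ((a' \<circ> (top b ^^ s)) \<circ> (delta_op ^^ s)) + (Y + c)"
      unfolding Y(2) add.assoc ..
    have lead: "a' \<circ> (top b ^^ s) \<in> MW (w - of_int m + real s * e - 2 * real s)"
      by (rule MW_cong[OF MW_comp[OF a' pow]]) simp
    have "?c \<in> RW (w - of_int m + real s * e)"
      unfolding c_eq by (rule ordlt_RW[OF ordlt_SucI[OF lead ordlt_add[OF Y(1) c]]])
    moreover have "ord ?c = ereal (real s)"
      by (rule ord_top(2)[OF lead MW_comp_nonzero[OF a' a'_nz pow pow_nz] ordlt_add[OF Y(1) c] c_eq])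
    \<comment> \<open>The division multiplies \<open>a\<close> by \<open>b'\<close> first and by the
      power of \<open>top b\<close> afterwards; these two commute.\<close>
    moreover have "a \<circ> (top b ^^ s) \<circ> b' = (b \<circ> ?c) + c'"
      using right_step[OF b(1,3,4) a' ordlt_RW[OF c, unfolded e_def] refl E]
      by (simp only: comp_assoc MW_commute[OF pow b'])
    ultimately show ?thesis using ordlt_RW[OF c'] ord_ordlt[OF c'] by blast
  qed
  ultimately show ?thesis
    unfolding Rk_eq p q ij(2,3) s_def[symmetric] op_add_eq by (intro conjI)
qed

end
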